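(* Consider the filtering problem with observed state increments: the hidden state $\mathbf{X}_t\in\mathbb{R}^N$ and the observation process $\mathbf{U}_t\in\mathbb{R}^M$ satisfy $$d\mathbf{X}_t=\mathbf{f}(\mathbf{X}_t,t)\,dt+\Sigma_x^{1/2}\,d\mathbf{W}_t,\qquad d\mathbf{U}_t=C\,d\mathbf{X}_t+\Sigma_u^{1/2}\,d\mathbf{V}_t .$$ Let $\{p_\theta:\boldsymbol\theta=(\theta_1,\dots,\theta_m)\in\Theta\}$ be a finite-dimensional parametric family of probability densities on $\mathbb{R}^N$. Then the projection filter onto this family (the Stratonovich SDE for $\boldsymbol\theta$ defined in the context) is given, for $j=1,\dots,m$, by $$\begin{aligned} d\theta_j=&\sum_i g^{ij}\bigg[\mathbb{E}_\theta\Big[\tilde{\mathcal{L}}\Big[\tfrac{\partial\log p_\theta}{\partial\theta_i}\Big]\Big]-\frac12\bigg(\mathbb{E}_\theta\Big[\|\tilde\Sigma_u^{-1/2}C\,\mathbf{f}_t\|^2\,\tfrac{\partial\log p_\theta}{\partial\theta_i}\Big]\\ &\qquad+\mathbb{E}_\theta\Big[\mathrm{Tr}\big(\tilde\Sigma_u^{-1}C\,J_f\,\Sigma_x C^T\big)\,\tfrac{\partial\log p_\theta}{\partial\theta_i}\Big]\bigg)\bigg]dt\\ &+\sum_i g^{ij}\bigg(\mathbb{E}_\theta\Big[\tfrac{\partial\log p_\theta}{\partial\theta_i}\,\mathbf{f}_t\Big]+\Sigma_x\,\mathbb{E}_\theta\Big[\nabla\tfrac{\partial\log p_\theta}{\partial\theta_i}\Big]\bigg)^{T}C^T\tilde\Sigma_u^{-1}\circ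 d\mathbf{U}_t, \end{aligned}$$ where $(J_f)_{ij}=\partial f_i/\partial x_j$ is the Jacobian matrix of $\mathbf f_t$ and, for scalar functions $\phi$ of $\mathbf{x}$ with Hessian $H_\phi$, the modified generator $\tilde{\mathcal L}$ is $$\tilde{\mathcal{L}}[\phi]:=(\nabla\phi(\mathbf{x}))^TC^{-1}\Sigma_u\tilde\Sigma_u^{-1}C\,\mathbf{f}_t(\mathbf{x})+\tfrac12\mathrm{Tr}\big(H_\phi\,\Sigma_x\,C^{-1}\Sigma_u\tilde\Sigma_u^{-1}C\big).$$
   Context: Setting. $\mathbf{W}_t$ and $\mathbf{V}_t$ are independent standard Brownian motions in $\mathbb{R}^N$ and $\mathbb{R}^M$; $\mathbf f:\mathbb{R}^N\times\mathbb{R}\to\mathbb{R}^N$ and $\mathbf{f}_t(\mathbf{x})=\mathbf{f}(\mathbf{x},t)$; $C\in\mathbb{R}^{M\times N}$ is such that the inverse $C^{-1}$ appearing in $\tilde{\mathcal L}$ exists (so $M=N$ and $C$ is invertible); $\Sigma_x\in\mathbb{R}^{N\times N}$ and $\Sigma_u\in\mathbb{R}^{M\times M}$ are constant covariance matrices; $\tilde\Sigma_u=C\Sigma_xC^T+\Sigma_u$ is invertible. The generator of $\mathbf{X}_t$ is $\mathcal{L}[\phi]=\mathbf{f}_t^T\nabla\phi+\frac12\mathrm{Tr}(H_\phi\Sigma_x)$. Gradients $\nabla$ and Hessians are with respect to $\mathbf{x}$, $\|\cdot\|$ is the Euclidean norm, and $\circ$ denotes Stratonovich integration. All functions and densities are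 assumed regular enough that all expressions, exchanges of derivative and integral, and SDEs make sense. Filtering equation. Let $p_t$ be the conditional density of $\mathbf{X}_t$ given the observations $U_{0:t}=\{\mathbf{U}_\tau:\tau<t\}$, and write $\mathbb{E}[\phi_t]=\int\phi\,p_t\,d\mathbf{x}$. The posterior expectations evolve according to the generalized Kushner–Stratonovich equation (Itô form) $$d\mathbb{E}[\phi_t]=\mathbb{E}[\mathcal{L}[\phi_t]]\,dt+\big(\mathrm{cov}(\phi_t,\mathbf{f}_t)+\Sigma_x\mathbb{E}[\nabla\phi_t]\big)^TC^T\tilde\Sigma_u^{-1}\big(d\mathbf{U}_t-C\,\mathbb{E}[\mathbf{f}_t]\,dt\big),$$ with $\mathrm{cov}(\phi_t,\mathbf{f}_t)=\mathbb{E}[\phi_t\mathbf{f}_t]-\mathbb{E}[\phi_t]\mathbb{E}[\mathbf{f}_t]$. Rewriting this evolution in Stratonovich form, for the density, gives $dp_t=\mathcal{A}^\dagger[p_t]\,dt+\mathcal{B}^\dagger[p_t]\circ d\mathbf{U}_t$; this defines the maps $\mathcal{A}^\dagger$ and $\mathcal{B}^\dagger$ (the latter with values in row vectors of length $M$). Projection filter. Let $\mathcal{S}=\{p_\theta:\boldsymbol\theta\in\Theta\}$ with tangent space $T_\theta\mathcal{S}=\mathrm{Span}(\partial p_\theta/\partial\theta_1,\dots,\partial p_\theta/\partial\theta_m)$. $\mathbb{E}_\theta$ is expectation under $p_\theta$. The Fisher metric is $g_{ij}=\mathbb{E}_\theta\big[\frac{\partial\log p_\theta}{\partial\theta_i}\frac{\partial\log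 p_\theta}{\partial\theta_j}\big]$, with components $g^{ij}$ of its inverse, and the associated inner product is $\langle Z_1,Z_2\rangle_\theta=\int Z_1Z_2/p_\theta\,d\mathbf{x}$. The orthogonal projection is $\Pi_\theta[Z]=\sum_{i,j}g^{ij}\langle Z,\partial p_\theta/\partial\theta_i\rangle_\theta\,\partial p_\theta/\partial\theta_j$. The projection filter is the evolution on $\mathcal{S}$ obtained by projecting the Stratonovich vector fields, $dp_\theta=\Pi_\theta[\mathcal{A}^\dagger[p_\theta]]\,dt+\Pi_\theta[\mathcal{B}^\dagger[p_\theta]]\circ d\mathbf{U}_t$; equivalently, the Stratonovich SDE $$d\theta_j=\sum_ig^{ij}\Big\langle\mathcal{A}^\dagger[p_\theta],\tfrac{\partial p_\theta}{\partial\theta_i}\Big\rangle_\theta dt+\sum_ig^{ij}\Big\langle\mathcal{B}^\dagger[p_\theta],\tfrac{\partial p_\theta}{\partial\theta_i}\Big\rangle_\theta\circ d\mathbf{U}_t .$$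
   Formalization: With P = C^{-1}Σ_uΣ̃_u^{-1}C, the second-order term of the modified generator is corrected from ½Tr(H_φ Σ_x P) to ½Tr(H_φ P Σ_x), as the printed order is false in general; the printed form is proved when Σ_x commutes with P. *)

theory Defs
  imports "HOL-Probability.Probability"
begin

section \<open>Calculus on \<open>\<real>\<^sup>n\<close>\<close>

definition partial :: "'n::finite \<Rightarrow> (real^'n \<Rightarrow> real) \<Rightarrow> real^'n \<Rightarrow> real" where
  "partial i \<phi> x = frechet_derivative \<phi> (at x) (axis i 1)"

definition grad :: "(real^'n::finite \<Rightarrow> real) \<Rightarrow> real^'n \<Rightarrow> real^'n" where
  "grad \<phi> x = (\<chi> i. partial i \<phi> x)"

definition hess :: "(real^'n::finite \<Rightarrow> real) \<Rightarrow> real^'n \<Rightarrow> real^'n^'n" where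
  "hess \<phi> x = (\<chi> i j. partial i (partial j \<phi>) x)"

definition C1 :: "(real^'n::finite \<Rightarrow> real) \<Rightarrow> bool" where
  "C1 \<phi> \<longleftrightarrow> (\<forall>x. \<phi> differentiable (at x)) \<and> (\<forall>i. continuous_on UNIV (partial i \<phi>))"

definition C2 :: "(real^'n::finite \<Rightarrow> real) \<Rightarrow> bool" where
  "C2 \<phi> \<longleftrightarrow> C1 \<phi> \<and> (\<forall>i. C1 (partial i \<phi>))"

definition compactly_supported :: "(real^'n::finite \<Rightarrow> real) \<Rightarrow> bool" where
  "compactly_supported \<phi> \<longleftrightarrow> (\<exists>R. \<forall>x. R < norm x \<longrightarrow> \<phi> x = 0)"


section \<open>Covariance matrices\<close>

definition covariance_matrix :: "real^'n^'n::finite \<Rightarrow> bool" where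
  "covariance_matrix S \<longleftrightarrow> transpose S = S \<and> (\<forall>v. 0 \<le> v \<bullet> (S *v v))"

definition is_sqrt_of :: "real^'n^'n::finite \<Rightarrow> real^'n^'n \<Rightarrow> bool" where
  "is_sqrt_of R S \<longleftrightarrow> covariance_matrix R \<and> R ** R = S"

definition obs_cov :: "real^'n::finite^'m::finite \<Rightarrow> real^'n^'n \<Rightarrow> real^'m^'m \<Rightarrow> real^'m^'m" where
  "obs_cov C Sx Su = C ** Sx ** transpose C + Su"


section \<open>Brownian motion and the filtering model\<close>

text \<open>Time is \<open>[0, \<infinity>)\<close>; processes and filtrations are indexed by all reals only because this is
  the available index type, and values at negative times are never used.\<close>

definition brownian_motion ::
  "'w measure \<Rightarrow> (real \<Rightarrow> 'w measure) \<Rightarrow> (real \<Rightarrow> 'w \<Rightarrow> real^'n::finite) \<Rightarrow> bool" where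
  "brownian_motion M F Z \<longleftrightarrow>
     (\<forall>t\<ge>0. Z t \<in> borel_measurable (F t)) \<and>
     (AE \<omega> in M. Z 0 \<omega> = 0 \<and> continuous_on {0..} (\<lambda>t. Z t \<omega>)) \<and>
     (\<forall>s t. 0 \<le> s \<longrightarrow> s < t \<longrightarrow>
        (\<forall>i. distributed M lborel (\<lambda>\<omega>. (Z t \<omega> - Z s \<omega>) $ i) (normal_density 0 (sqrt (t - s)))) \<and>
        prob_space.indep_vars M (\<lambda>_. borel) (\<lambda>i \<omega>. (Z t \<omega> - Z s \<omega>) $ i) UNIV \<and>
        prob_space.indep_set M (sets (F s))
          {(\<lambda>\<omega>. Z t \<omega> - Z s \<omega>) -` E \<inter> space M | E. E \<in> sets borel})"

text \<open>Two processes are independent standard Brownian motions, relative to a common filtration,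
  iff the stacked process is a standard Brownian motion in the product space.\<close>

definition stacked ::
  "(real \<Rightarrow> 'w \<Rightarrow> real^'n::finite) \<Rightarrow> (real \<Rightarrow> 'w \<Rightarrow> real^'m::finite) \<Rightarrow> real \<Rightarrow> 'w \<Rightarrow> real^('n + 'm)" where
  "stacked W V t \<omega> = (\<chi> k. case k of Inl i \<Rightarrow> W t \<omega> $ i | Inr a \<Rightarrow> V t \<omega> $ a)"

text \<open>The noise coefficients are constant, so the stochastic differential equations of the model
  need no stochastic integral. \<open>Rx\<close> and \<open>Ru\<close> play the role of the square roots of
  \<open>\<Sigma>\<^sub>x\<close> and \<open>\<Sigma>\<^sub>u\<close>.\<close>

definition filtering_model ::
  "'w measure \<Rightarrow> (real \<Rightarrow> 'w measure) \<Rightarrow> (real^'n \<Rightarrow> real \<Rightarrow> real^'n) \<Rightarrow>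
   real^'n::finite^'m::finite \<Rightarrow> real^'n^'n \<Rightarrow> real^'m^'m \<Rightarrow>
   (real \<Rightarrow> 'w \<Rightarrow> real^'n) \<Rightarrow> (real \<Rightarrow> 'w \<Rightarrow> real^'m) \<Rightarrow>
   (real \<Rightarrow> 'w \<Rightarrow> real^'n) \<Rightarrow> (real \<Rightarrow> 'w \<Rightarrow> real^'m) \<Rightarrow> bool" where
  "filtering_model M F f C Rx Ru W V X U \<longleftrightarrow>
     prob_space M \<and> filtration (space M) F \<and> (\<forall>t. subalgebra M (F t)) \<and>
     brownian_motion M F (stacked W V) \<and>
     (\<forall>t\<ge>0. X t \<in> borel_measurable (F t) \<and> U t \<in> borel_measurable (F t)) \<and>
     (AE \<omega> in M. continuous_on {0..} (\<lambda>t. X t \<omega>) \<and>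
        (\<forall>t\<ge>0.
           set_integrable lborel {0..t} (\<lambda>s. f (X s \<omega>) s) \<and>
           X t \<omega> = X 0 \<omega> + (LINT s:{0..t}|lborel. f (X s \<omega>) s) + Rx *v W t \<omega> \<and>
           U t \<omega> = U 0 \<omega> + C *v (X t \<omega> - X 0 \<omega>) + Ru *v V t \<omega>))"


section \<open>Stratonovich integrals and equations\<close>

definition partition_of :: "real \<Rightarrow> nat \<Rightarrow> (nat \<Rightarrow> real) \<Rightarrow> bool" where
  "partition_of t n \<tau> \<longleftrightarrow> \<tau> 0 = 0 \<and> \<tau> n = t \<and> (\<forall>k<n. \<tau> k \<le> \<tau> (Suc k))"

text \<open>\<open>I\<close> is the limit in probability of the trapezoidal sums, as the mesh of the
  partition of \<open>[0, t]\<close> tends to zero.\<close>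

definition has_stratonovich_integral ::
  "'w measure \<Rightarrow> (real \<Rightarrow> 'w \<Rightarrow> real^'m::finite) \<Rightarrow> (real \<Rightarrow> 'w \<Rightarrow> real^'m) \<Rightarrow> real \<Rightarrow> ('w \<Rightarrow> real) \<Rightarrow> bool"
where
  "has_stratonovich_integral M Y U t I \<longleftrightarrow>
     I \<in> borel_measurable M \<and>
     (\<forall>s\<in>{0..t}. Y s \<in> borel_measurable M \<and> U s \<in> borel_measurable M) \<and>
     (\<forall>\<epsilon>>0. \<forall>\<eta>>0. \<exists>\<delta>>0. \<forall>n \<tau>.
        partition_of t n \<tau> \<longrightarrow> (\<forall>k<n. \<tau> (Suc k) - \<tau> k < \<delta>) \<longrightarrow>
        measure M {\<omega> \<in> space M. \<epsilon> <
          \<bar>(\<Sum>k<n. ((1/2) *\<^sub>R (Y (\<tau> k) \<omega> + Y (\<tau> (Suc k)) \<omega>)) \<bullet> (U (\<tau> (Suc k)) \<omega> - U (\<tau> k) \<omega>))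
             - I \<omega>\<bar>} < \<eta>)"

text \<open>\<open>d\<theta> = \<mu>(\<theta>, t) dt + \<sigma>(\<theta>, t) \<circ> dU\<close>
  for a continuous adapted process with values in \<open>\<Theta>\<close>.\<close>

definition solves_stratonovich_sde ::
  "'w measure \<Rightarrow> (real \<Rightarrow> 'w measure) \<Rightarrow> (real^'k::finite) set \<Rightarrow>
   (real^'k \<Rightarrow> real \<Rightarrow> real^'k) \<Rightarrow> (real^'k \<Rightarrow> real \<Rightarrow> real^'m::finite^'k) \<Rightarrow>
   (real \<Rightarrow> 'w \<Rightarrow> real^'m) \<Rightarrow> (real \<Rightarrow> 'w \<Rightarrow> real^'k) \<Rightarrow> bool" where
  "solves_stratonovich_sde M F \<Theta> \<mu> \<sigma> U \<theta> \<longleftrightarrow>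
     (\<forall>t\<ge>0. \<theta> t \<in> borel_measurable (F t)) \<and>
     (\<forall>t\<ge>0. \<forall>\<omega>\<in>space M. \<theta> t \<omega> \<in> \<Theta>) \<and>
     (AE \<omega> in M. continuous_on {0..} (\<lambda>t. \<theta> t \<omega>)) \<and>
     (\<forall>t\<ge>0. \<forall>j. \<exists>I. has_stratonovich_integral M (\<lambda>s \<omega>. \<sigma> (\<theta> s \<omega>) s $ j) U t I \<and>
        (AE \<omega> in M.
           set_integrable lborel {0..t} (\<lambda>s. \<mu> (\<theta> s \<omega>) s $ j) \<and>
           \<theta> t \<omega> $ j = \<theta> 0 \<omega> $ j + (LINT s:{0..t}|lborel. \<mu> (\<theta> s \<omega>) s $ j) + I \<omega>))"


section \<open>The Kushner--Stratonovich equation\<close>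

text \<open>Expectations are linear functionals of \<open>p\<close>, which need not be a probability density: they
  are also applied to tangent directions.\<close>

definition expect ::
  "(real^'n::finite \<Rightarrow> real) \<Rightarrow> (real^'n \<Rightarrow> 'b::{banach, second_countable_topology}) \<Rightarrow> 'b" where
  "expect p g = (LINT x|lborel. p x *\<^sub>R g x)"

definition covar ::
  "(real^'n::finite \<Rightarrow> real) \<Rightarrow> (real^'n \<Rightarrow> real) \<Rightarrow> (real^'n \<Rightarrow> real^'n) \<Rightarrow> real^'n" where
  "covar p \<phi> f = expect p (\<lambda>x. \<phi> x *\<^sub>R f x) - expect p \<phi> *\<^sub>R expect p f"

definition state_generator ::
  "real^'n^'n \<Rightarrow> (real^'n \<Rightarrow> real^'n) \<Rightarrow> (real^'n::finite \<Rightarrow> real) \<Rightarrow> real^'n \<Rightarrow> real" where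
  "state_generator Sx f \<phi> x = f x \<bullet> grad \<phi> x + 1/2 * trace (hess \<phi> x ** Sx)"

text \<open>Row vectors of length \<open>M\<close> are elements of \<open>real^'m\<close>, and \<open>v v* A\<close> is the
  product of the row vector \<open>v\<^sup>T\<close> with \<open>A\<close>. The Kushner--Stratonovich equation reads
  \<open>d E[\<phi>] = ks_drift dt + ks_gain dU\<close> in Ito form.\<close>

definition ks_gain ::
  "real^'n::finite^'m::finite \<Rightarrow> real^'n^'n \<Rightarrow> real^'m^'m \<Rightarrow> (real^'n \<Rightarrow> real^'n) \<Rightarrow>
   (real^'n \<Rightarrow> real) \<Rightarrow> (real^'n \<Rightarrow> real) \<Rightarrow> real^'m" where
  "ks_gain C Sx Su f p \<phi> =
     (covar p \<phi> f + Sx *v expect p (grad \<phi>)) v* (transpose C ** matrix_inv (obs_cov C Sx Su))"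

definition ks_drift ::
  "real^'n::finite^'m::finite \<Rightarrow> real^'n^'n \<Rightarrow> real^'m^'m \<Rightarrow> (real^'n \<Rightarrow> real^'n) \<Rightarrow>
   (real^'n \<Rightarrow> real) \<Rightarrow> (real^'n \<Rightarrow> real) \<Rightarrow> real" where
  "ks_drift C Sx Su f p \<phi> =
     expect p (state_generator Sx f \<phi>) - ks_gain C Sx Su f p \<phi> \<bullet> (C *v expect p f)"

text \<open>The Ito-to-Stratonovich conversion of \<open>dY = a(Y) dt + b(Y) dU\<close>, where
  \<open>d[U] = Q dt\<close>, subtracts \<open>1/2 \<Sum>\<^sub>a\<^sub>b Q\<^sub>a\<^sub>b (D b\<^sub>a(Y))[b\<^sub>b(Y)]\<close>
  from the drift. Here \<open>Y\<close> is the density \<open>p\<close>, observed through the linear functional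
  \<open>E[\<phi>]\<close>, \<open>Q = C \<Sigma>\<^sub>x C\<^sup>T + \<Sigma>\<^sub>u\<close>, and the noise vector fields
  at \<open>p\<close> are the components of the function \<open>Bp\<close>.\<close>

definition ks_stratonovich_drift ::
  "real^'n::finite^'m::finite \<Rightarrow> real^'n^'n \<Rightarrow> real^'m^'m \<Rightarrow> (real^'n \<Rightarrow> real^'n) \<Rightarrow>
   (real^'n \<Rightarrow> real) \<Rightarrow> (real^'n \<Rightarrow> real^'m) \<Rightarrow> (real^'n \<Rightarrow> real) \<Rightarrow> real" where
  "ks_stratonovich_drift C Sx Su f p Bp \<phi> =
     ks_drift C Sx Su f p \<phi>
     - 1/2 * (\<Sum>a\<in>UNIV. \<Sum>b\<in>UNIV. obs_cov C Sx Su $ a $ b *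
         deriv (\<lambda>\<epsilon>. ks_gain C Sx Su f (\<lambda>x. p x + \<epsilon> * Bp x $ b) \<phi> $ a) 0)"

text \<open>\<open>Ap\<close> and \<open>Bp\<close> are the values at the density \<open>p\<close> of the maps
  \<open>\<A>\<^sup>\<dagger>\<close> and \<open>\<B>\<^sup>\<dagger>\<close>, that is, the densities of the Stratonovich drift and
  noise functionals. The equations for all test functions determine \<open>Ap\<close> and \<open>Bp\<close> up
  to null sets.\<close>

definition stratonovich_density_form ::
  "real^'n::finite^'m::finite \<Rightarrow> real^'n^'n \<Rightarrow> real^'m^'m \<Rightarrow> (real^'n \<Rightarrow> real^'n) \<Rightarrow>
   (real^'n \<Rightarrow> real) \<Rightarrow> (real^'n \<Rightarrow> real) \<Rightarrow> (real^'n \<Rightarrow> real^'m) \<Rightarrow> bool" where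
  "stratonovich_density_form C Sx Su f p Ap Bp \<longleftrightarrow>
     (\<forall>k a. integrable lborel (\<lambda>x. f x $ k * Bp x $ a)) \<and>
     (\<forall>\<phi> a. C1 \<phi> \<longrightarrow> compactly_supported \<phi> \<longrightarrow>
        integrable lborel (\<lambda>x. \<phi> x * Bp x $ a) \<and>
        (LINT x|lborel. \<phi> x * Bp x $ a) = ks_gain C Sx Su f p \<phi> $ a) \<and>
     (\<forall>\<phi>. C2 \<phi> \<longrightarrow> compactly_supported \<phi> \<longrightarrow>
        integrable lborel (\<lambda>x. \<phi> x * Ap x) \<and>
        (LINT x|lborel. \<phi> x * Ap x) = ks_stratonovich_drift C Sx Su f p Bp \<phi>)"


section \<open>Parametric families and the projection filter\<close>

definition tangent :: "(real^'k::finite \<Rightarrow> 's \<Rightarrow> real) \<Rightarrow> real^'k \<Rightarrow> 'k \<Rightarrow> 's \<Rightarrow> real" where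
  "tangent p \<theta> i x = partial i (\<lambda>\<eta>. p \<eta> x) \<theta>"

definition score :: "(real^'k::finite \<Rightarrow> 's \<Rightarrow> real) \<Rightarrow> real^'k \<Rightarrow> 'k \<Rightarrow> 's \<Rightarrow> real" where
  "score p \<theta> i x = partial i (\<lambda>\<eta>. ln (p \<eta> x)) \<theta>"

definition fisher :: "(real^'k::finite \<Rightarrow> real^'n::finite \<Rightarrow> real) \<Rightarrow> real^'k \<Rightarrow> real^'k^'k" where
  "fisher p \<theta> = (\<chi> i j. expect (p \<theta>) (\<lambda>x. score p \<theta> i x * score p \<theta> j x))"

definition fisher_inner ::
  "(real^'n::finite \<Rightarrow> real) \<Rightarrow> (real^'n \<Rightarrow> real) \<Rightarrow> (real^'n \<Rightarrow> real) \<Rightarrow> real" where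
  "fisher_inner q Z1 Z2 = (LINT x|lborel. Z1 x * Z2 x / q x)"

text \<open>The coordinates of the orthogonal projection \<open>\<Pi>\<^sub>\<theta>[Z]\<close> with respect to the
  \<open>tangent p \<theta> j\<close>.\<close>

definition projection_coord ::
  "(real^'k::finite \<Rightarrow> real^'n::finite \<Rightarrow> real) \<Rightarrow> real^'k \<Rightarrow> (real^'n \<Rightarrow> real) \<Rightarrow> real^'k" where
  "projection_coord p \<theta> Z =
     (\<chi> j. \<Sum>i\<in>UNIV. matrix_inv (fisher p \<theta>) $ i $ j * fisher_inner (p \<theta>) Z (tangent p \<theta> i))"

definition projection_drift ::
  "(real^'k::finite \<Rightarrow> real^'n::finite \<Rightarrow> real) \<Rightarrow>
   (real \<Rightarrow> (real^'n \<Rightarrow> real) \<Rightarrow> real^'n \<Rightarrow> real) \<Rightarrow> real^'k \<Rightarrow> real \<Rightarrow> real^'k" where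
  "projection_drift p A \<theta> t = projection_coord p \<theta> (A t (p \<theta>))"

definition projection_gain ::
  "(real^'k::finite \<Rightarrow> real^'n::finite \<Rightarrow> real) \<Rightarrow>
   (real \<Rightarrow> (real^'n \<Rightarrow> real) \<Rightarrow> real^'n \<Rightarrow> real^'m::finite) \<Rightarrow> real^'k \<Rightarrow> real \<Rightarrow> real^'m^'k" where
  "projection_gain p B \<theta> t = (\<chi> j a. projection_coord p \<theta> (\<lambda>x. B t (p \<theta>) x $ a) $ j)"


section \<open>Regularity\<close>

text \<open>The last clause but one is the exchange of \<open>\<partial>/\<partial>\<theta>\<^sub>i\<close> with the integral
  over \<open>x\<close>.\<close>

definition regular_family ::
  "(real^'k::finite) set \<Rightarrow> (real^'k \<Rightarrow> real^'n::finite \<Rightarrow> real) \<Rightarrow> bool" where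
  "regular_family \<Theta> p \<longleftrightarrow> open \<Theta> \<and>
     (\<forall>\<theta>\<in>\<Theta>.
        (\<forall>x. 0 < p \<theta> x) \<and> integrable lborel (p \<theta>) \<and> (LINT x|lborel. p \<theta> x) = 1 \<and>
        (\<forall>x. (\<lambda>\<eta>. p \<eta> x) differentiable (at \<theta>)) \<and>
        (\<forall>i. C2 (score p \<theta> i)) \<and>
        (\<forall>i j. integrable lborel (\<lambda>x. p \<theta> x * (score p \<theta> i x * score p \<theta> j x))) \<and>
        (\<forall>i. integrable lborel (tangent p \<theta> i) \<and>
             (LINT x|lborel. tangent p \<theta> i x) = partial i (\<lambda>\<eta>. LINT x|lborel. p \<eta> x) \<theta>) \<and>
        invertible (fisher p \<theta>))"

text \<open>Existence of the expectations in the filter equations for a drift \<open>f\<close>, a density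
  \<open>q\<close> and a score \<open>\<psi>\<close>.\<close>

definition moments_exist ::
  "(real^'n::finite \<Rightarrow> real^'n) \<Rightarrow> (real^'n \<Rightarrow> real) \<Rightarrow> (real^'n \<Rightarrow> real) \<Rightarrow> bool" where
  "moments_exist f q \<psi> \<longleftrightarrow>
     (\<forall>k l.
        integrable lborel (\<lambda>x. q x * f x $ k) \<and>
        integrable lborel (\<lambda>x. q x * (f x $ k * f x $ l)) \<and>
        integrable lborel (\<lambda>x. q x * (\<psi> x * f x $ k)) \<and>
        integrable lborel (\<lambda>x. q x * (\<psi> x * f x $ k * f x $ l)) \<and>
        integrable lborel (\<lambda>x. q x * partial k \<psi> x) \<and>
        integrable lborel (\<lambda>x. q x * (partial k \<psi> x * f x $ l)) \<and>
        integrable lborel (\<lambda>x. q x * (\<psi> x * jacobian f (at x) $ k $ l)) \<and>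
        integrable lborel (\<lambda>x. q x * partial k (partial l \<psi>) x))"


section \<open>The explicit filter equations\<close>

definition attenuation :: "real^'n::finite^'m::finite \<Rightarrow> real^'n^'n \<Rightarrow> real^'m^'m \<Rightarrow> real^'n^'n" where
  "attenuation C Sx Su = matrix_inv C ** Su ** matrix_inv (obs_cov C Sx Su) ** C"

definition modified_generator ::
  "real^'n::finite^'m::finite \<Rightarrow> real^'n^'n \<Rightarrow> real^'m^'m \<Rightarrow> (real^'n \<Rightarrow> real^'n) \<Rightarrow>
   (real^'n \<Rightarrow> real) \<Rightarrow> real^'n \<Rightarrow> real" where
  "modified_generator C Sx Su f \<phi> x =
     grad \<phi> x \<bullet> (attenuation C Sx Su *v f x)
     + 1/2 * trace (hess \<phi> x ** attenuation C Sx Su ** Sx)"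

text \<open>The variant with the last two factors under the trace in the opposite order. The two
  agree whenever \<open>Sx\<close> commutes with \<open>attenuation C Sx Su\<close>, for instance if \<open>Sx\<close> is
  a multiple of the identity, but not in general.\<close>

definition modified_generator_swapped ::
  "real^'n::finite^'m::finite \<Rightarrow> real^'n^'n \<Rightarrow> real^'m^'m \<Rightarrow> (real^'n \<Rightarrow> real^'n) \<Rightarrow>
   (real^'n \<Rightarrow> real) \<Rightarrow> real^'n \<Rightarrow> real" where
  "modified_generator_swapped C Sx Su f \<phi> x =
     grad \<phi> x \<bullet> (attenuation C Sx Su *v f x)
     + 1/2 * trace (hess \<phi> x ** Sx ** attenuation C Sx Su)"

text \<open>\<open>R\<close> is the square root of \<open>obs_cov C Sx Su\<close>, and \<open>L\<close> the modified generator at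
  each time.\<close>

definition explicit_drift ::
  "real^'n::finite^'m::finite \<Rightarrow> real^'n^'n \<Rightarrow> real^'m^'m \<Rightarrow> real^'m^'m \<Rightarrow>
   (real^'n \<Rightarrow> real \<Rightarrow> real^'n) \<Rightarrow> (real^'k::finite \<Rightarrow> real^'n \<Rightarrow> real) \<Rightarrow>
   (real \<Rightarrow> (real^'n \<Rightarrow> real) \<Rightarrow> real^'n \<Rightarrow> real) \<Rightarrow> real^'k \<Rightarrow> real \<Rightarrow> real^'k" where
  "explicit_drift C Sx Su R f p L \<theta> t =
     (\<chi> j. \<Sum>i\<in>UNIV. matrix_inv (fisher p \<theta>) $ i $ j *
        (expect (p \<theta>) (L t (score p \<theta> i))
         - 1/2 *
           (expect (p \<theta>) (\<lambda>x. (norm (matrix_inv R *v (C *v f x t)))\<^sup>2 * score p \<theta> i x)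
            + expect (p \<theta>) (\<lambda>x.
                trace (matrix_inv (obs_cov C Sx Su) ** C ** jacobian (\<lambda>y. f y t) (at x)
                       ** Sx ** transpose C) * score p \<theta> i x))))"

definition explicit_gain ::
  "real^'n::finite^'m::finite \<Rightarrow> real^'n^'n \<Rightarrow> real^'m^'m \<Rightarrow>
   (real^'n \<Rightarrow> real \<Rightarrow> real^'n) \<Rightarrow> (real^'k::finite \<Rightarrow> real^'n \<Rightarrow> real) \<Rightarrow>
   real^'k \<Rightarrow> real \<Rightarrow> real^'m^'k" where
  "explicit_gain C Sx Su f p \<theta> t =
     (\<chi> j. \<Sum>i\<in>UNIV. matrix_inv (fisher p \<theta>) $ i $ j *\<^sub>R
        ((expect (p \<theta>) (\<lambda>x. score p \<theta> i x *\<^sub>R f x t)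
          + Sx *v expect (p \<theta>) (grad (score p \<theta> i)))
         v* (transpose C ** matrix_inv (obs_cov C Sx Su))))"

end

theory Submission
  imports Defs
begin

text \<open>
  Write \<open>\<psi>\<close> for a score and \<open>q\<close> for the density, so that a tangent vector is \<open>q \<psi>\<close> and the coefficients
  of the projection are \<open>\<integral> \<psi> A\<close> and \<open>\<integral> \<psi> B\<close>. If \<open>\<psi>\<close> had compact support, these would be the Stratonovich
  drift and noise functionals of the Kushner--Stratonovich equation at the test function \<open>\<psi>\<close>. The Ito
  correction is evaluated by applying the noise functional again, to the test functions \<open>\<phi> f\<^sub>k\<close> and
  \<open>\<partial>\<^sub>l \<phi>\<close>. With \<open>P = C\<^sup>T Q\<inverse> C\<close>, where \<open>Q\<close> is the observation covariance, the correction cancels the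
  quadratic term \<open>v \<bullet> P E[f]\<close> of the drift, and it turns the generator into the modified generator because
  \<open>1 - \<Sigma>\<^sub>x P = C\<inverse> \<Sigma>\<^sub>u Q\<inverse> C\<close>. The only other remainder is a multiple of \<open>E[\<phi>]\<close>, and \<open>E[\<psi>] = 0\<close>.

  Scores need not have compact support, so for every compactly supported \<open>\<phi>\<close> the outcome is written as the
  vanishing of the integral of a linear second-order operator applied to \<open>\<phi>\<close>. Replacing \<open>\<phi>\<close> by \<open>\<chi>\<^sub>n \<psi>\<close> with
  cutoffs \<open>\<chi>\<^sub>n\<close>, dominated convergence extends the identity to \<open>\<psi>\<close>.
\<close>

section \<open>Partial derivatives and compact support\<close>

lemma partial_eqI:
  assumes "(\<phi> has_derivative D) (at x)"
  shows "partial i \<phi> x = D (axis i 1)"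
  using frechet_derivative_at[OF assms] by (simp add: partial_def)

lemma partial_add:
  assumes "\<phi> differentiable (at x)" "\<psi> differentiable (at x)"
  shows "partial i (\<lambda>x. \<phi> x + \<psi> x) x = partial i \<phi> x + partial i \<psi> x"
  unfolding partial_def using assms
  by (subst frechet_derivative_at[symmetric])
    (auto intro!: derivative_eq_intros simp: frechet_derivative_works[symmetric])

lemma partial_mult:
  assumes "\<phi> differentiable (at x)" "\<psi> differentiable (at x)"
  shows "partial i (\<lambda>x. \<phi> x * \<psi> x) x = \<phi> x * partial i \<psi> x + partial i \<phi> x * \<psi> x"
proof -
  have "((\<lambda>x. \<phi> x * \<psi> x) has_derivative
      (\<lambda>h. \<phi> x * frechet_derivative \<psi> (at x) h + frechet_derivative \<phi> (at x) h * \<psi> x)) (at x)"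
    using assms by (intro has_derivative_mult) (auto simp: frechet_derivative_works[symmetric])
  from partial_eqI[OF this] show ?thesis by (simp add: partial_def)
qed

lemma C1_differentiable: "C1 \<phi> \<Longrightarrow> \<phi> differentiable (at x)"
  and C1_continuous_partial: "C1 \<phi> \<Longrightarrow> continuous_on UNIV (partial i \<phi>)"
  by (auto simp: C1_def)

lemma C1_continuous: "C1 \<phi> \<Longrightarrow> continuous_on UNIV \<phi>"
  by (simp add: C1_def continuous_at_imp_continuous_on differentiable_imp_continuous_within)

lemma C2_imp_C1: "C2 \<phi> \<Longrightarrow> C1 \<phi>"
  and C2_imp_C1_partial: "C2 \<phi> \<Longrightarrow> C1 (partial i \<phi>)"
  by (auto simp: C2_def)

text \<open>An equation between functions, so that it can rewrite inside \<open>C1\<close> and under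
  an outer \<open>partial\<close>, where the product rule at a single point does not apply.\<close>

lemma partial_mult_C1:
  assumes "C1 \<phi>" "C1 \<psi>"
  shows "partial i (\<lambda>x. \<phi> x * \<psi> x) = (\<lambda>x. \<phi> x * partial i \<psi> x + partial i \<phi> x * \<psi> x)"
  using assms by (auto simp: partial_mult C1_def)

lemma C1_add: "C1 \<phi> \<Longrightarrow> C1 \<psi> \<Longrightarrow> C1 (\<lambda>x. \<phi> x + \<psi> x)"
  by (auto simp: C1_def partial_add cong: continuous_on_cong intro!: continuous_intros)

lemma C1_mult:
  assumes "C1 \<phi>" "C1 \<psi>"
  shows "C1 (\<lambda>x. \<phi> x * \<psi> x)"
  unfolding C1_def partial_mult_C1[OF assms]
  using assms by (auto intro!: continuous_intros simp: C1_continuous C1_continuous_partial C1_differentiable)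

lemma C2_mult:
  assumes "C2 \<phi>" "C2 \<psi>"
  shows "C2 (\<lambda>x. \<phi> x * \<psi> x)"
  unfolding C2_def partial_mult_C1[OF assms[THEN C2_imp_C1]]
  using assms by (auto intro!: C1_mult C1_add simp: C2_imp_C1 C2_imp_C1_partial)

lemma partial_partial_mult_C2:
  assumes "C2 \<phi>" "C2 \<psi>"
  shows "partial i (partial j (\<lambda>x. \<phi> x * \<psi> x)) = (\<lambda>x.
    \<phi> x * partial i (partial j \<psi>) x + partial i \<phi> x * partial j \<psi> x
    + (partial j \<phi> x * partial i \<psi> x + partial i (partial j \<phi>) x * \<psi> x))"
  unfolding partial_mult_C1[OF assms[THEN C2_imp_C1]]
  by (rule ext, subst partial_add)
    (auto intro!: C1_differentiable C1_mult simp: partial_mult_C1 C2_imp_C1 C2_imp_C1_partial assms)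

lemma compactly_supported_mult: "compactly_supported \<phi> \<Longrightarrow> compactly_supported (\<lambda>x. \<phi> x * \<psi> x)"
  by (auto simp: compactly_supported_def)

text \<open>The set of points of norm greater than \<open>R\<close> is open, so \<phi> vanishes in a
  neighbourhood of each of them and has derivative zero there.\<close>

lemma compactly_supported_partial:
  assumes "compactly_supported \<phi>"
  shows "compactly_supported (partial i \<phi>)"
proof -
  obtain R where R: "\<And>x. R < norm x \<Longrightarrow> \<phi> x = 0"
    using assms by (auto simp: compactly_supported_def)
  have "partial i \<phi> x = 0" if "R < norm x" for x
  proof -
    have "(\<phi> has_derivative (\<lambda>_. 0)) (at x)"
      by (rule has_derivative_transform_within_open[where f="\<lambda>_. 0" and s="{x. R < norm x}"])
        (use that R in \<open>auto intro!: open_Collect_less continuous_intros\<close>)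
    from partial_eqI[OF this] show ?thesis .
  qed
  then show ?thesis by (auto simp: compactly_supported_def)
qed

section \<open>Boundedness and integrability for factors of compact support\<close>

lemma compactly_supported_continuous_bounded:
  fixes g :: "real^'n::finite \<Rightarrow> real"
  assumes "continuous_on UNIV g" "compactly_supported g"
  obtains K where "\<And>x. \<bar>g x\<bar> \<le> K"
proof -
  obtain R where R: "\<And>x. R < norm x \<Longrightarrow> g x = 0"
    using assms by (auto simp: compactly_supported_def)
  have "compact (g ` cball 0 R)"
    by (rule compact_continuous_image) (use assms continuous_on_subset in auto)
  then obtain K where K: "\<And>x. x \<in> cball 0 R \<Longrightarrow> \<bar>g x\<bar> \<le> K"
    using compact_imp_bounded bounded_iff by (metis image_eqI real_norm_def)
  \<comment> \<open>\<open>K\<close> bounds \<open>g\<close> on the ball only. If \<open>R\<close>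
    is negative the ball is empty and \<open>K\<close> may be negative, while \<open>g\<close>
    vanishes everywhere.\<close>
  have "\<bar>g x\<bar> \<le> max K 0" for x
    using K[of x] R[of x] by (cases "norm x \<le> R") auto
  with that show ?thesis by blast
qed

lemma integrable_mult_bounded:
  fixes w :: "real^'n::finite \<Rightarrow> real"
  assumes w: "integrable lborel w" and g: "g \<in> borel_measurable borel" "\<And>x. \<bar>g x\<bar> \<le> K"
  shows "integrable lborel (\<lambda>x. w x * g x)"
proof (rule Bochner_Integration.integrable_bound[where f="\<lambda>x. K * w x"])
  show "(\<lambda>x. w x * g x) \<in> borel_measurable lborel"
    using borel_measurable_integrable[OF w] g by measurable
  have "0 \<le> K" using g(2)[of 0] by linarith
  then show "AE x in lborel. norm (w x * g x) \<le> norm (K * w x)"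
    using g(2) by (auto simp: abs_mult mult.commute intro!: AE_I2 mult_right_mono)
qed (use w in simp)

lemma integrable_mult_compactly_supported:
  fixes w :: "real^'n::finite \<Rightarrow> real"
  assumes "integrable lborel w" "continuous_on UNIV g" "compactly_supported g"
  shows "integrable lborel (\<lambda>x. w x * g x)"
  using compactly_supported_continuous_bounded[OF assms(2,3)]
  by (metis assms(1,2) integrable_mult_bounded borel_measurable_continuous_onI)

section \<open>Cutoff functions\<close>

text \<open>The third power is the smallest one that makes the cutoff twice continuously differentiable.\<close>

definition cutoff :: "nat \<Rightarrow> real^'n::finite \<Rightarrow> real" where
  "cutoff n x = (max 0 (1 - (x \<bullet> x) / (real (Suc n))\<^sup>2)) ^ 3"

text \<open>Away from the kink at 1 the function is locally a polynomial or zero. At the kink an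
  exponent of at least 2 makes both one-sided derivatives vanish.\<close>

lemma has_field_derivative_max_0_power:
  "((\<lambda>s. max 0 (1 - s) ^ Suc (Suc k)) has_field_derivative - real (Suc (Suc k)) * max 0 (1 - s) ^ Suc k) (at (s::real))"
proof -
  consider "s < 1" | "s > 1" | "s = 1" by linarith
  then show ?thesis
  proof cases
    case 1
    have "((\<lambda>s. 1 - s) has_field_derivative - 1) (at s)"
      by (auto intro!: derivative_eq_intros)
    from DERIV_power[OF this, of "Suc (Suc k)"]
    have "((\<lambda>s. (1 - s) ^ Suc (Suc k)) has_field_derivative - real (Suc (Suc k)) * (1 - s) ^ Suc k) (at s)"
      by (simp del: power_Suc of_nat_Suc)
    then have "((\<lambda>s. max 0 (1 - s) ^ Suc (Suc k)) has_field_derivative - real (Suc (Suc k)) * (1 - s) ^ Suc k) (at s)"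
      by (rule has_field_derivative_transform_within_open[where S="{..<1}"]) (use 1 in auto)
    with 1 show ?thesis by simp
  next
    case 2
    have "((\<lambda>s. max 0 (1 - s) ^ Suc (Suc k)) has_field_derivative 0) (at s)"
      by (rule has_field_derivative_transform_within_open[where S="{1<..}" and f="\<lambda>_. 0"]) (use 2 in auto)
    with 2 show ?thesis by simp
  next
    case 3
    \<comment> \<open>This is the difference quotient at 1, where the function itself is 0. It is
      dominated by a positive power of the absolute value of \<open>h\<close>.\<close>
    have "((\<lambda>h::real. max 0 (- h) ^ Suc (Suc k) / h) \<longlongrightarrow> 0) (at 0)"
    proof (rule Lim_null_comparison[where g="\<lambda>h. \<bar>h\<bar> ^ Suc k"])
      have "norm (max 0 (- h) ^ Suc (Suc k) / h) \<le> \<bar>h\<bar> ^ Suc k" for h :: real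
      proof (cases "h = 0")
        case False
        have "max 0 (- h) ^ Suc (Suc k) \<le> \<bar>h\<bar> ^ Suc (Suc k)" by (rule power_mono) auto
        with False show ?thesis by (simp add: abs_mult divide_simps mult_ac)
      qed simp
      then show "\<forall>\<^sub>F h in at 0. norm (max 0 (- h) ^ Suc (Suc k) / h) \<le> \<bar>h\<bar> ^ Suc k" by simp
      have "((\<lambda>h::real. \<bar>h\<bar> ^ Suc k) \<longlongrightarrow> \<bar>0\<bar> ^ Suc k) (at 0)" by (intro tendsto_intros)
      then show "((\<lambda>h::real. \<bar>h\<bar> ^ Suc k) \<longlongrightarrow> 0) (at 0)" by simp
    qed
    with 3 show ?thesis by (simp add: DERIV_def)
  qed
qed

lemma has_derivative_max_0_power:
  fixes x :: "real^'n::finite"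
  assumes "c > 0"
  shows "((\<lambda>x. max 0 (1 - (x \<bullet> x) / c) ^ Suc (Suc k)) has_derivative
     (\<lambda>h. - real (Suc (Suc k)) * max 0 (1 - (x \<bullet> x) / c) ^ Suc k * (2 * (x \<bullet> h) / c))) (at x)"
proof -
  have "((\<lambda>x. (x \<bullet> x) / c) has_derivative (\<lambda>h. 2 * (x \<bullet> h) / c)) (at x)"
    using assms by (auto intro!: derivative_eq_intros simp: inner_commute field_simps)
  from has_derivative_compose[OF this has_field_derivative_max_0_power[unfolded has_field_derivative_def]]
  show ?thesis .
qed

lemma partial_max_0_power:
  fixes x :: "real^'n::finite"
  assumes "c > 0"
  shows "partial i (\<lambda>x. max 0 (1 - (x \<bullet> x) / c) ^ Suc (Suc k)) x =
     - real (Suc (Suc k)) * max 0 (1 - (x \<bullet> x) / c) ^ Suc k * (2 * x $ i / c)"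
  using partial_eqI[OF has_derivative_max_0_power[OF assms], of i k x] by (simp add: inner_axis)

text \<open>Differentiation lowers the exponent by one, to at least 1, so the derivative is still
  continuous across the sphere where the base reaches 0.\<close>

lemma C1_max_0_power:
  assumes "c > 0"
  shows "C1 (\<lambda>x::real^'n::finite. max 0 (1 - (x \<bullet> x) / c) ^ Suc (Suc k))"
  unfolding C1_def partial_max_0_power[OF assms, abs_def]
  using has_derivative_max_0_power[OF assms] assms
  by (auto simp: differentiable_def intro!: continuous_intros)

lemma C1_component: "C1 (\<lambda>x::real^'n::finite. c * x $ i)"
  and partial_component: "partial j (\<lambda>x::real^'n::finite. c * x $ i) = (\<lambda>_. if i = j then c else 0)"
proof -
  have D: "((\<lambda>x::real^'n. c * x $ i) has_derivative (\<lambda>h. c * h $ i)) (at x)" for x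
    by (intro bounded_linear_imp_has_derivative bounded_linear_const_mult bounded_linear_vec_nth)
  show p: "partial j (\<lambda>x::real^'n. c * x $ i) = (\<lambda>_. if i = j then c else 0)" for j
    using partial_eqI[OF D] by (auto simp: axis_def)
  show "C1 (\<lambda>x::real^'n. c * x $ i)"
    unfolding C1_def p using D by (auto simp: differentiable_def)
qed

text \<open>The chain rule gives -3 times 2, hence the constant -6. The linear factor stands apart
  so that \<open>C1_mult\<close> and \<open>C1_component\<close> apply to the product.\<close>

lemma partial_cutoff:
  "partial i (cutoff n) = (\<lambda>x::real^'n::finite.
     max 0 (1 - (x \<bullet> x) / (real (Suc n))\<^sup>2) ^ 2 * (- 6 / (real (Suc n))\<^sup>2 * x $ i))"
  unfolding cutoff_def[abs_def] numeral_3_eq_3 numeral_2_eq_2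
  by (rule ext, subst partial_max_0_power) auto

lemma C2_cutoff: "C2 (cutoff n :: real^'n::finite \<Rightarrow> real)"
  unfolding C2_def
proof (intro conjI allI)
  show "C1 (cutoff n :: real^'n \<Rightarrow> real)"
    using C1_max_0_power[of "(real (Suc n))\<^sup>2" 1]
    by (simp add: cutoff_def[abs_def] numeral_3_eq_3 del: of_nat_Suc power_Suc)
  have "C1 (\<lambda>x::real^'n. max 0 (1 - (x \<bullet> x) / (real (Suc n))\<^sup>2) ^ 2)"
    using C1_max_0_power[of "(real (Suc n))\<^sup>2" 0] by (simp add: numeral_2_eq_2)
  then show "C1 (partial i (cutoff n :: real^'n \<Rightarrow> real))" for i
    unfolding partial_cutoff by (rule C1_mult[OF _ C1_component])
qed

lemma partial_partial_cutoff:
  "partial j (partial i (cutoff n)) x =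
     max 0 (1 - (x \<bullet> x) / (real (Suc n))\<^sup>2) ^ 2 * (if i = j then - 6 / (real (Suc n))\<^sup>2 else 0)
     + (- 2 * max 0 (1 - (x \<bullet> x) / (real (Suc n))\<^sup>2) * (2 * x $ j / (real (Suc n))\<^sup>2))
        * (- 6 / (real (Suc n))\<^sup>2 * x $ i)"
  for x :: "real^'n::finite"
proof -
  have "C1 (\<lambda>x::real^'n. max 0 (1 - (x \<bullet> x) / (real (Suc n))\<^sup>2) ^ 2)"
    and "partial j (\<lambda>x::real^'n. max 0 (1 - (x \<bullet> x) / (real (Suc n))\<^sup>2) ^ 2) x
      = - 2 * max 0 (1 - (x \<bullet> x) / (real (Suc n))\<^sup>2) * (2 * x $ j / (real (Suc n))\<^sup>2)"
    using C1_max_0_power[of "(real (Suc n))\<^sup>2" 0] partial_max_0_power[of "(real (Suc n))\<^sup>2" j 0]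
    by (auto simp: numeral_2_eq_2)
  then show ?thesis
    by (simp only: partial_cutoff partial_mult_C1 C1_component partial_component)
qed

section \<open>Bounds and pointwise limits of the cutoffs and their derivatives\<close>

lemma max_0_bounds:
  fixes x :: "'a::real_inner"
  assumes "c > 0"
  shows "max 0 (1 - (x \<bullet> x) / c\<^sup>2) \<in> {0..1}"
    and "c < norm x \<Longrightarrow> max 0 (1 - (x \<bullet> x) / c\<^sup>2) = 0"
proof -
  show "max 0 (1 - (x \<bullet> x) / c\<^sup>2) \<in> {0..1}" by simp
  assume "c < norm x"
  then have "c\<^sup>2 < x \<bullet> x" using assms by (metis dot_square_norm power_strict_mono less_eq_real_def zero_less_numeral)
  then show "max 0 (1 - (x \<bullet> x) / c\<^sup>2) = 0" using assms by simp
qed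

lemma compactly_supported_cutoff: "compactly_supported (cutoff n)"
  using max_0_bounds(2)[of "real (Suc n)"]
  by (auto simp: compactly_supported_def cutoff_def simp del: of_nat_Suc intro!: exI[of _ "real (Suc n)"])

lemma abs_cutoff_le: "\<bar>cutoff n x\<bar> \<le> 1"
  using max_0_bounds(1)[of "real (Suc n)" x] by (auto simp: cutoff_def power_le_one)

text \<open>Only the ball of radius \<open>Suc n\<close> matters. There a coordinate is at most the
  radius, which cancels one of the two powers of the radius in the denominator.\<close>

lemma abs_partial_cutoff_le: "\<bar>partial i (cutoff n) x\<bar> \<le> 6 / real (Suc n)" for x :: "real^'n::finite"
proof (cases "real (Suc n) < norm x")
  case True
  then show ?thesis using max_0_bounds(2)[of "real (Suc n)" x] by (simp add: partial_cutoff del: of_nat_Suc)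
next
  case False
  let ?m = "max 0 (1 - (x \<bullet> x) / (real (Suc n))\<^sup>2)"
  have x: "\<bar>x $ i\<bar> \<le> real (Suc n)" using False component_le_norm_cart[of x i] by linarith
  have m: "\<bar>?m ^ 2\<bar> \<le> 1" using max_0_bounds(1)[of "real (Suc n)" x] by (auto simp: power_le_one abs_if)
  have "\<bar>partial i (cutoff n) x\<bar> = \<bar>?m ^ 2\<bar> * (6 / (real (Suc n))\<^sup>2 * \<bar>x $ i\<bar>)"
    by (simp add: partial_cutoff abs_mult)
  also have "\<dots> \<le> 1 * (6 / (real (Suc n))\<^sup>2 * real (Suc n))"
    by (intro mult_mono m x) auto
  finally show ?thesis by (simp add: power2_eq_square del: of_nat_Suc)
qed

text \<open>The constant is 6 + 24. The first summand comes from differentiating the linear factor,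
  the second from differentiating the squared factor, where the product of two coordinates cancels
  two of four powers of the radius.\<close>

lemma abs_partial_partial_cutoff_le:
  "\<bar>partial j (partial i (cutoff n)) x\<bar> \<le> 30 / (real (Suc n))\<^sup>2" for x :: "real^'n::finite"
proof (cases "real (Suc n) < norm x")
  case True
  then show ?thesis using max_0_bounds(2)[of "real (Suc n)" x]
    by (simp add: partial_partial_cutoff del: of_nat_Suc)
next
  case False
  let ?N = "real (Suc n)"
  let ?m = "max 0 (1 - (x \<bullet> x) / ?N\<^sup>2)"
  have x: "\<bar>x $ k\<bar> \<le> ?N" for k using False component_le_norm_cart[of x k] by linarith
  have m: "\<bar>?m\<bar> \<le> 1" "\<bar>?m ^ 2\<bar> \<le> 1"
    using max_0_bounds(1)[of ?N x] by (auto simp: power_le_one abs_if)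
  let ?a = "?m ^ 2 * (if i = j then - 6 / ?N\<^sup>2 else 0)"
    and ?b = "(- 2 * ?m * (2 * x $ j / ?N\<^sup>2)) * (- 6 / ?N\<^sup>2 * x $ i)"
  have "\<bar>?a\<bar> \<le> 1 * (6 / ?N\<^sup>2)"
    unfolding abs_mult by (intro mult_mono m) auto
  moreover have "\<bar>?b\<bar> = 24 / (?N\<^sup>2)\<^sup>2 * \<bar>?m\<bar> * (\<bar>x $ j\<bar> * \<bar>x $ i\<bar>)"
    by (simp add: abs_mult power2_eq_square)
  moreover have "24 / (?N\<^sup>2)\<^sup>2 * \<bar>?m\<bar> * (\<bar>x $ j\<bar> * \<bar>x $ i\<bar>) \<le> 24 / (?N\<^sup>2)\<^sup>2 * 1 * (?N * ?N)"
    by (intro mult_mono m x order_refl) auto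
  moreover have "24 / (?N\<^sup>2)\<^sup>2 * 1 * (?N * ?N) = 24 / ?N\<^sup>2"
    by (simp add: power2_eq_square del: of_nat_Suc)
  moreover have "30 / ?N\<^sup>2 = 6 / ?N\<^sup>2 + 24 / ?N\<^sup>2"
    by (simp add: add_divide_distrib[symmetric])
  moreover have "\<bar>?a + ?b\<bar> \<le> \<bar>?a\<bar> + \<bar>?b\<bar>" by (rule abs_triangle_ineq)
  ultimately show ?thesis
    unfolding partial_partial_cutoff by linarith
qed

lemma tendsto_const_div_Suc: "(\<lambda>n. a / real (Suc n)) \<longlonglongrightarrow> 0"
  by (rule LIMSEQ_Suc[OF lim_const_over_n])

lemma tendsto_const_div_Suc_power2: "(\<lambda>n. a / (real (Suc n))\<^sup>2) \<longlonglongrightarrow> 0"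
  using tendsto_mult[OF tendsto_const_div_Suc[of a] tendsto_const_div_Suc[of 1]]
  by (simp add: power2_eq_square)

lemma cutoff_tendsto: "(\<lambda>n. cutoff n x) \<longlonglongrightarrow> 1"
proof -
  have "(\<lambda>n. max 0 (1 - (x \<bullet> x) / (real (Suc n))\<^sup>2) ^ 3) \<longlonglongrightarrow> max 0 (1 - 0) ^ 3"
    by (intro tendsto_intros tendsto_const_div_Suc_power2)
  then show ?thesis by (simp add: cutoff_def)
qed

lemma partial_cutoff_tendsto: "(\<lambda>n. partial i (cutoff n) x) \<longlonglongrightarrow> 0" for x :: "real^'n::finite"
  by (rule Lim_null_comparison[OF _ tendsto_const_div_Suc[of 6]]) (intro always_eventually allI, unfold real_norm_def, rule abs_partial_cutoff_le)

lemma partial_partial_cutoff_tendsto: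
  "(\<lambda>n. partial j (partial i (cutoff n)) x) \<longlonglongrightarrow> 0" for x :: "real^'n::finite"
  by (rule Lim_null_comparison[OF _ tendsto_const_div_Suc_power2[of 30]])
    (intro always_eventually allI, unfold real_norm_def, rule abs_partial_partial_cutoff_le)

text \<open>Dominated convergence with majorant \<open>K\<close> times the absolute value of
  \<open>w\<close>. The limit \<open>c\<close> is 1 for the cutoffs and 0 for their first and second
  partial derivatives.\<close>

lemma integral_mult_tendsto:
  fixes w :: "real^'n::finite \<Rightarrow> real"
  assumes w: "integrable lborel w"
    and g: "\<And>n. g n \<in> borel_measurable borel" "\<And>n x. \<bar>g n x\<bar> \<le> K" "\<And>x. (\<lambda>n. g n x) \<longlonglongrightarrow> c"
  shows "(\<lambda>n. LINT x|lborel. w x * g n x) \<longlonglongrightarrow> c * (LINT x|lborel. w x)"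
proof -
  have "(\<lambda>n. LINT x|lborel. w x * g n x) \<longlonglongrightarrow> (LINT x|lborel. w x * c)"
  proof (rule integral_dominated_convergence[where w="\<lambda>x. K * \<bar>w x\<bar>"])
    show "(\<lambda>x. w x * c) \<in> borel_measurable lborel" "\<And>n. (\<lambda>x. w x * g n x) \<in> borel_measurable lborel"
      using borel_measurable_integrable[OF w] g(1) by measurable
    show "integrable lborel (\<lambda>x. K * \<bar>w x\<bar>)" using w by simp
    show "AE x in lborel. (\<lambda>n. w x * g n x) \<longlonglongrightarrow> w x * c"
      using g(3) by (auto intro!: tendsto_intros)
    show "AE x in lborel. norm (w x * g n x) \<le> K * \<bar>w x\<bar>" for n
      using g(2) by (auto simp: abs_mult mult.commute[of K] intro!: AE_I2 mult_left_mono)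
  qed
  then show ?thesis by (simp add: mult.commute)
qed

lemma measurable_cutoff [measurable]:
  "(cutoff n :: real^'n::finite \<Rightarrow> real) \<in> borel_measurable borel"
  "partial i (cutoff n :: real^'n::finite \<Rightarrow> real) \<in> borel_measurable borel"
  "partial i (partial j (cutoff n :: real^'n::finite \<Rightarrow> real)) \<in> borel_measurable borel"
  by (intro borel_measurable_continuous_onI C1_continuous C2_imp_C1 C2_cutoff C1_continuous_partial
      C2_imp_C1_partial)+

context
  fixes w :: "real^'n::finite \<Rightarrow> real"
  assumes w: "integrable lborel w"
begin

lemma integrable_mult_cutoff: "integrable lborel (\<lambda>x. w x * cutoff n x)"
  and integrable_mult_partial_cutoff: "integrable lborel (\<lambda>x. w x * partial i (cutoff n) x)"
  and integrable_mult_partial_partial_cutoff: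
    "integrable lborel (\<lambda>x. w x * partial i (partial j (cutoff n)) x)"
  by (intro integrable_mult_compactly_supported w compactly_supported_partial compactly_supported_cutoff
      C1_continuous C2_imp_C1 C2_cutoff C1_continuous_partial C2_imp_C1_partial)+

lemma integral_mult_cutoff_tendsto:
  "(\<lambda>n. LINT x|lborel. w x * cutoff n x) \<longlonglongrightarrow> (LINT x|lborel. w x)"
  using integral_mult_tendsto[OF w measurable_cutoff(1) abs_cutoff_le cutoff_tendsto] by simp

lemma integral_mult_partial_cutoff_tendsto:
  "(\<lambda>n. LINT x|lborel. w x * partial i (cutoff n) x) \<longlonglongrightarrow> 0"
proof -
  have "\<bar>partial i (cutoff n) x\<bar> \<le> 6" for n and x :: "real^'n"
    by (rule order_trans[OF abs_partial_cutoff_le]) (simp add: divide_simps)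
  from integral_mult_tendsto[OF w measurable_cutoff(2) this partial_cutoff_tendsto] show ?thesis by simp
qed

lemma integral_mult_partial_partial_cutoff_tendsto:
  "(\<lambda>n. LINT x|lborel. w x * partial i (partial j (cutoff n)) x) \<longlonglongrightarrow> 0"
proof -
  have "30 / (real (Suc n))\<^sup>2 \<le> 30 / 1" for n
    by (intro divide_left_mono) (auto simp del: of_nat_Suc simp: one_le_power)
  then have "\<bar>partial i (partial j (cutoff n)) x\<bar> \<le> 30" for n and x :: "real^'n"
    using abs_partial_partial_cutoff_le[of i j n x] by (smt (verit) div_by_1)
  from integral_mult_tendsto[OF w measurable_cutoff(3) this partial_partial_cutoff_tendsto]
  show ?thesis by simp
qed

end

text \<open>Test with the cutoff times \<psi>. By the product rule the integrand is the desired one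
  times the cutoff, plus terms in which some derivative falls on the cutoff; the latter vanish in
  the limit. Integrability is assumed coefficient by coefficient because the limit is taken in each
  integral separately.\<close>

lemma weak_identity_extends:
  fixes c \<psi> :: "real^'n::finite \<Rightarrow> real" and b :: "'n \<Rightarrow> real^'n \<Rightarrow> real" and a :: "'n \<Rightarrow> 'n \<Rightarrow> real^'n \<Rightarrow> real"
  assumes \<psi>: "C2 \<psi>"
    and c: "integrable lborel (\<lambda>x. c x * \<psi> x)"
    and b: "\<And>i. integrable lborel (\<lambda>x. b i x * \<psi> x)"
      "\<And>i. integrable lborel (\<lambda>x. b i x * partial i \<psi> x)"
    and a: "\<And>i j. integrable lborel (\<lambda>x. a i j x * \<psi> x)"
      "\<And>i j k. integrable lborel (\<lambda>x. a i j x * partial k \<psi> x)"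
      "\<And>i j. integrable lborel (\<lambda>x. a i j x * partial i (partial j \<psi>) x)"
    and weak: "\<And>\<phi>. C2 \<phi> \<Longrightarrow> compactly_supported \<phi> \<Longrightarrow>
      (LINT x|lborel. c x * \<phi> x + (\<Sum>i\<in>UNIV. b i x * partial i \<phi> x)
        + (\<Sum>i\<in>UNIV. \<Sum>j\<in>UNIV. a i j x * partial i (partial j \<phi>) x)) = 0"
  shows "(LINT x|lborel. c x * \<psi> x + (\<Sum>i\<in>UNIV. b i x * partial i \<psi> x)
        + (\<Sum>i\<in>UNIV. \<Sum>j\<in>UNIV. a i j x * partial i (partial j \<psi>) x)) = 0"
proof -
  note int = integrable_mult_cutoff integrable_mult_partial_cutoff integrable_mult_partial_partial_cutoff
  let ?\<chi> = "cutoff :: nat \<Rightarrow> real^'n \<Rightarrow> real"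
  \<comment> \<open>The left side is independent of \<open>n\<close>. Each second-order coefficient
    yields four integrals: no derivative on the cutoff, one in either index, or both.\<close>
  have expand: "0 = (LINT x|lborel. (c x * \<psi> x) * ?\<chi> n x)
      + (\<Sum>i\<in>UNIV. (LINT x|lborel. (b i x * partial i \<psi> x) * ?\<chi> n x)
            + (LINT x|lborel. (b i x * \<psi> x) * partial i (?\<chi> n) x))
      + (\<Sum>i\<in>UNIV. \<Sum>j\<in>UNIV. (LINT x|lborel. (a i j x * partial i (partial j \<psi>) x) * ?\<chi> n x)
            + (LINT x|lborel. (a i j x * partial j \<psi> x) * partial i (?\<chi> n) x)
            + (LINT x|lborel. (a i j x * partial i \<psi> x) * partial j (?\<chi> n) x)
            + (LINT x|lborel. (a i j x * \<psi> x) * partial i (partial j (?\<chi> n)) x))" for n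
  proof -
    let ?\<phi> = "\<lambda>x. ?\<chi> n x * \<psi> x"
    have "0 = (LINT x|lborel. c x * ?\<phi> x + (\<Sum>i\<in>UNIV. b i x * partial i ?\<phi> x)
        + (\<Sum>i\<in>UNIV. \<Sum>j\<in>UNIV. a i j x * partial i (partial j ?\<phi>) x))"
      by (rule weak[symmetric]) (intro C2_mult C2_cutoff \<psi> compactly_supported_mult compactly_supported_cutoff)+
    also have "\<dots> = (LINT x|lborel. (c x * \<psi> x) * ?\<chi> n x
      + (\<Sum>i\<in>UNIV. (b i x * partial i \<psi> x) * ?\<chi> n x + (b i x * \<psi> x) * partial i (?\<chi> n) x)
      + (\<Sum>i\<in>UNIV. \<Sum>j\<in>UNIV. (a i j x * partial i (partial j \<psi>) x) * ?\<chi> n x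
            + (a i j x * partial j \<psi> x) * partial i (?\<chi> n) x
            + (a i j x * partial i \<psi> x) * partial j (?\<chi> n) x
            + (a i j x * \<psi> x) * partial i (partial j (?\<chi> n)) x))"
      unfolding partial_partial_mult_C2[OF C2_cutoff \<psi>]
      unfolding partial_mult_C1[OF C2_imp_C1[OF C2_cutoff] C2_imp_C1[OF \<psi>]]
      by (intro Bochner_Integration.integral_cong arg_cong2[where f="(+)"] sum.cong refl) (simp_all add: algebra_simps)
    finally show ?thesis
      by (simp only: Bochner_Integration.integral_add Bochner_Integration.integral_sum
        Bochner_Integration.integrable_add Bochner_Integration.integrable_sum int a b c)
  qed
  have "(\<lambda>n. (LINT x|lborel. (c x * \<psi> x) * ?\<chi> n x)
      + (\<Sum>i\<in>UNIV. (LINT x|lborel. (b i x * partial i \<psi> x) * ?\<chi> n x)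
            + (LINT x|lborel. (b i x * \<psi> x) * partial i (?\<chi> n) x))
      + (\<Sum>i\<in>UNIV. \<Sum>j\<in>UNIV. (LINT x|lborel. (a i j x * partial i (partial j \<psi>) x) * ?\<chi> n x)
            + (LINT x|lborel. (a i j x * partial j \<psi> x) * partial i (?\<chi> n) x)
            + (LINT x|lborel. (a i j x * partial i \<psi> x) * partial j (?\<chi> n) x)
            + (LINT x|lborel. (a i j x * \<psi> x) * partial i (partial j (?\<chi> n)) x)))
    \<longlonglongrightarrow> (LINT x|lborel. c x * \<psi> x) + (\<Sum>i\<in>UNIV. (LINT x|lborel. b i x * partial i \<psi> x) + 0)
      + (\<Sum>i\<in>UNIV. \<Sum>j\<in>UNIV. (LINT x|lborel. a i j x * partial i (partial j \<psi>) x) + 0 + 0 + 0)"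
    by (intro tendsto_add tendsto_sum integral_mult_cutoff_tendsto integral_mult_partial_cutoff_tendsto
        integral_mult_partial_partial_cutoff_tendsto a b c)
  \<comment> \<open>By \<open>expand\<close> the convergent sequence is constantly 0, so its limit
    is 0.\<close>
  then have "0 = (LINT x|lborel. c x * \<psi> x) + (\<Sum>i\<in>UNIV. (LINT x|lborel. b i x * partial i \<psi> x) + 0)
      + (\<Sum>i\<in>UNIV. \<Sum>j\<in>UNIV. (LINT x|lborel. a i j x * partial i (partial j \<psi>) x) + 0 + 0 + 0)"
    unfolding expand[symmetric] by (simp only: LIMSEQ_const_iff)
  then show ?thesis
    by (simp only: Bochner_Integration.integral_add Bochner_Integration.integral_sum
      Bochner_Integration.integrable_add Bochner_Integration.integrable_sum a b c add_0_right)
qed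

section \<open>Matrix algebra\<close>

definition outer :: "real^'n::finite \<Rightarrow> real^'m::finite \<Rightarrow> real^'m^'n" where
  "outer u v = (\<chi> i j. u $ i * v $ j)"

lemma outer_component [simp]: "outer u v $ i = u $ i *\<^sub>R v" "transpose (outer u v) = outer v u"
  by (auto simp: outer_def vec_eq_iff transpose_def)

text \<open>Makes a bilinear form linear in the single matrix \<open>outer u v\<close>, so that an
  expectation can be moved inside the trace.\<close>

lemma trace_outer_mult: "trace (outer u v ** A) = v \<bullet> (A *v u)" for A :: "real^'n::finite^'m::finite"
  by (simp add: trace_def outer_def matrix_matrix_mult_def matrix_vector_mult_def inner_vec_def
      sum_distrib_left mult_ac) (subst sum.swap, simp add: mult_ac)

lemma trace_outer: "trace (outer u v) = u \<bullet> v" for u v :: "real^'n::finite"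
  by (simp add: trace_def inner_vec_def)

lemma trace_transpose: "trace (transpose A) = trace A" for A :: "real^'n::finite^'n"
  by (simp add: trace_def transpose_def)

lemma trace_scaleR: "trace (c *\<^sub>R A) = c * trace A" for A :: "real^'n::finite^'n"
  by (simp add: trace_def sum_distrib_left)

lemma matrix_mult_diff_distrib: "A ** (B - D) = A ** B - A ** D" "(B - D) ** E = B ** E - D ** E"
  for A :: "real^'n::finite^'m::finite" and B D :: "real^'k::finite^'n" and E :: "real^'l::finite^'k"
  by (simp_all add: matrix_matrix_mult_def vec_eq_iff algebra_simps sum_subtractf)

lemma matrix_mult_add_distrib: "A ** (B + D) = A ** B + A ** D" "(B + D) ** E = B ** E + D ** E"
  for A :: "real^'n::finite^'m::finite" and B D :: "real^'k::finite^'n" and E :: "real^'l::finite^'k"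
  by (simp_all add: matrix_matrix_mult_def vec_eq_iff algebra_simps sum.distrib)

lemma matrix_mult_scaleR: "A ** (c *\<^sub>R B) = c *\<^sub>R (A ** B)"  "(c *\<^sub>R A) ** B = c *\<^sub>R (A ** B)"
  for A :: "real^'n::finite^'m::finite" and B :: "real^'k::finite^'n"
  by (simp_all add: matrix_matrix_mult_def vec_eq_iff sum_distrib_left mult_ac)

lemma matrix_mult_component: "(A ** B) $ i = A $ i v* B"
  for A :: "real^'n::finite^'m::finite" and B :: "real^'k::finite^'n"
  by (simp add: matrix_matrix_mult_def vector_matrix_mult_def vec_eq_iff mult_ac)

lemma symmetric_inner_commute:
  "transpose A = A \<Longrightarrow> u \<bullet> (A *v v) = v \<bullet> (A *v u)" for A :: "real^'n::finite^'n"
  by (metis dot_lmul_matrix inner_commute transpose_matrix_vector)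

text \<open>The Ito correction in matrix form, with \<open>F = E[\<phi> f f\<^sup>T]\<close>, \<open>D = E[f (\<nabla>\<phi>)\<^sup>T]\<close>, \<open>J = E[\<phi> J\<^sub>f]\<close>,
  \<open>H = E[H\<^sub>\<phi>]\<close>, \<open>e = E[f]\<close>, \<open>m = E[\<phi> f]\<close>, \<open>n = E[\<nabla>\<phi>]\<close> and \<open>m0 = E[\<phi>]\<close>.\<close>

lemma trace_correction_terms:
  fixes F D J H Sx P :: "real^'n::finite^'n" and e m n :: "real^'n"
  assumes P: "transpose P = P" and Sx: "transpose Sx = Sx" and v: "v = m - m0 *\<^sub>R e + Sx *v n"
  shows "trace ((F - outer m e + (J + D) ** Sx - outer e v
        + Sx ** (transpose D - outer n e + transpose H ** Sx)) ** P)
    = trace (F ** P) + trace (J ** Sx ** P) + 2 * trace (D ** Sx ** P) + trace (H ** Sx ** P ** Sx)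
      - 2 * (v \<bullet> (P *v e)) - m0 * (e \<bullet> (P *v e))"
proof -
  \<comment> \<open>The mixed term occurs twice in the correction, once transposed. Invariance of
    the trace under transposition and cyclic rotation identifies the two copies and produces the
    factor 2; the Hessian term is reordered in the same way.\<close>
  have "trace (Sx ** transpose D ** P) = trace (transpose (Sx ** transpose D ** P))"
    by (simp only: trace_transpose)
  also have "\<dots> = trace (P ** (D ** Sx))"
    by (simp add: matrix_transpose_mul P Sx matrix_mul_assoc)
  finally have D: "trace (Sx ** transpose D ** P) = trace (D ** Sx ** P)"
    by (subst (asm) trace_mul_sym) 
  have "trace (Sx ** transpose H ** Sx ** P) = trace (transpose (Sx ** transpose H ** Sx ** P))"
    by (simp only: trace_transpose)
  also have "\<dots> = trace ((P ** Sx) ** (H ** Sx))"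
    by (simp add: matrix_transpose_mul P Sx matrix_mul_assoc)
  finally have H: "trace (Sx ** transpose H ** Sx ** P) = trace (H ** Sx ** P ** Sx)"
    by (subst (asm) trace_mul_sym) (simp only: matrix_mul_assoc)
  have "trace (Sx ** outer n e ** P) = trace (outer n e ** (P ** Sx))"
    by (subst trace_mul_sym[of Sx "outer n e ** P", unfolded matrix_mul_assoc]) (simp only: matrix_mul_assoc)
  also have "\<dots> = (Sx *v n) \<bullet> (P *v e)"
    unfolding trace_outer_mult matrix_vector_mul_assoc[symmetric] by (rule symmetric_inner_commute[OF P])
  finally have n: "trace (Sx ** outer n e ** P) = (Sx *v n) \<bullet> (P *v e)" .
  have m: "trace (outer m e ** P) = m \<bullet> (P *v e)"
    unfolding trace_outer_mult by (rule symmetric_inner_commute[OF P])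
  have ev: "trace (outer e v ** P) = v \<bullet> (P *v e)" by (rule trace_outer_mult)
  \<comment> \<open>The terms in \<open>m\<close> and \<open>n\<close> recombine to \<open>v\<close>
    up to the \<open>m0\<close> part of the covariance. Together with \<open>ev\<close> this gives
    the coefficient 2 of the quadratic term in \<open>v\<close>.\<close>
  have vv: "m \<bullet> (P *v e) + (Sx *v n) \<bullet> (P *v e) = v \<bullet> (P *v e) + m0 * (e \<bullet> (P *v e))"
    unfolding v by (simp add: inner_simps)
  show ?thesis
    unfolding matrix_mult_add_distrib matrix_mult_diff_distrib trace_add trace_sub matrix_mul_assoc D H n m ev
    using vv by (simp add: algebra_simps)
qed

text \<open>For \<open>G\<close> equal to the transpose of \<open>C\<close> times the inverse of
  \<open>Q\<close>, contraction with the quadratic variation \<open>Q\<close> cancels that inverse.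
  Column \<open>b\<close> of \<open>T\<close> stands for the derivative of the gain vector along
  noise direction \<open>b\<close>.\<close>

lemma sum_weighted_gain_eq_trace:
  fixes C :: "real^'n::finite^'m::finite" and Q :: "real^'m^'m" and G T :: "real^'m^'n"
  assumes "G ** Q = transpose C"
  shows "(\<Sum>a\<in>UNIV. \<Sum>b\<in>UNIV. Q $ a $ b * ((\<chi> k. T $ k $ b) v* G) $ a) = trace (C ** T)"
proof -
  have "(\<Sum>a\<in>UNIV. \<Sum>b\<in>UNIV. Q $ a $ b * ((\<chi> k. T $ k $ b) v* G) $ a)
      = (\<Sum>b\<in>UNIV. \<Sum>a\<in>UNIV. \<Sum>k\<in>UNIV. Q $ a $ b * (T $ k $ b * G $ k $ a))"
    by (subst sum.swap) (simp add: vector_matrix_mult_def sum_distrib_left mult_ac)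
  also have "\<dots> = (\<Sum>b\<in>UNIV. \<Sum>k\<in>UNIV. \<Sum>a\<in>UNIV. Q $ a $ b * (T $ k $ b * G $ k $ a))"
    by (rule sum.cong[OF refl], rule sum.swap)
  also have "\<dots> = (\<Sum>b\<in>UNIV. \<Sum>k\<in>UNIV. (G ** Q) $ k $ b * T $ k $ b)"
    by (simp add: matrix_matrix_mult_def sum_distrib_right sum_distrib_left mult_ac)
  also have "\<dots> = trace (C ** T)"
    unfolding assms by (simp add: trace_def matrix_matrix_mult_def transpose_def)
  finally show ?thesis .
qed

section \<open>Matrix inverses and the observation covariance\<close>

lemma matrix_inv_mult: "invertible A \<Longrightarrow> matrix_inv A ** A = mat 1" "invertible A \<Longrightarrow> A ** matrix_inv A = mat 1"
  for A :: "real^'n::finite^'m::finite"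
  \<comment> \<open>\<open>matrix_inv\<close> is a choice term, and invertibility supplies a witness
    for both equations. The two index types may differ, as they do for \<open>C\<close>.\<close>
  by (metis (mono_tags, lifting) invertible_def matrix_inv_def someI_ex)+

lemma matrix_inv_unique:
  fixes A :: "real^'n::finite^'m::finite"
  assumes "A ** B = mat 1" "B ** A = mat 1"
  shows "matrix_inv A = B"
proof -
  have "invertible A" using assms by (auto simp: invertible_def)
  then have "matrix_inv A ** (A ** B) = B" by (simp add: matrix_mul_assoc matrix_inv_mult)
  then show ?thesis by (simp add: assms)
qed

lemma transpose_matrix_inv: "invertible A \<Longrightarrow> transpose (matrix_inv A) = matrix_inv (transpose A)"
  for A :: "real^'n::finite^'n"
  by (rule matrix_inv_unique[symmetric]) (simp_all add: matrix_transpose_mul[symmetric] matrix_inv_mult)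

definition info_matrix :: "real^'n::finite^'m::finite \<Rightarrow> real^'n^'n \<Rightarrow> real^'m^'m \<Rightarrow> real^'n^'n" where
  "info_matrix C Sx Su = transpose C ** matrix_inv (obs_cov C Sx Su) ** C"

context
  fixes C :: "real^'n::finite^'m::finite" and Sx :: "real^'n^'n" and Su :: "real^'m^'m"
  assumes Sx: "covariance_matrix Sx" and Su: "covariance_matrix Su"
    and invertible: "invertible (obs_cov C Sx Su)"
begin

lemma transpose_obs_cov: "transpose (obs_cov C Sx Su) = obs_cov C Sx Su"
proof -
  have "transpose (X + Y) = transpose X + transpose Y" for X Y :: "real^'m^'m"
    by (simp add: transpose_def vec_eq_iff)
  then show ?thesis
    using Sx Su by (simp add: obs_cov_def covariance_matrix_def matrix_transpose_mul matrix_mul_assoc)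
qed

lemma transpose_info_matrix: "transpose (info_matrix C Sx Su) = info_matrix C Sx Su"
  by (simp add: info_matrix_def matrix_transpose_mul transpose_matrix_inv[OF invertible] transpose_obs_cov
      matrix_mul_assoc)

text \<open>Substitute the observation covariance minus \<open>C ** Sx ** transpose C\<close> for
  \<open>Su\<close>, then cancel each inverse against its matrix. The invertibility of
  \<open>C\<close> enters the drift computation through this identity.\<close>

lemma attenuation_eq:
  assumes C: "invertible C"
  shows "attenuation C Sx Su = mat 1 - Sx ** info_matrix C Sx Su"
proof -
  let ?Q = "obs_cov C Sx Su"
  have Su_eq: "Su = ?Q - C ** Sx ** transpose C" by (simp add: obs_cov_def)
  have "attenuation C Sx Su = matrix_inv C ** (?Q - C ** Sx ** transpose C) ** matrix_inv ?Q ** C"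
    using Su_eq by (simp add: attenuation_def)
  also have "\<dots> = matrix_inv C ** (?Q ** matrix_inv ?Q) ** C
      - (matrix_inv C ** C) ** Sx ** transpose C ** matrix_inv ?Q ** C"
    by (simp only: matrix_mult_diff_distrib matrix_mul_assoc)
  finally show ?thesis
    by (simp add: matrix_inv_mult invertible C info_matrix_def matrix_mul_assoc)
qed

text \<open>\<open>R\<close> is symmetric with square \<open>obs_cov C Sx Su\<close>, so its inverse
  is symmetric and squares to the inverse of that covariance. Moving one factor across the inner
  product gives the quadratic form.\<close>

lemma norm_matrix_inv_sqrt:
  assumes R: "is_sqrt_of R (obs_cov C Sx Su)"
  shows "(norm (matrix_inv R *v (C *v y)))\<^sup>2 = y \<bullet> (info_matrix C Sx Su *v y)"
proof -
  let ?Q = "obs_cov C Sx Su"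
  have RR: "R ** R = ?Q" and sym: "transpose R = R"
    using R by (auto simp: is_sqrt_of_def covariance_matrix_def)
  have "(matrix_inv ?Q ** R) ** R = mat 1"
    using RR by (simp add: matrix_mul_assoc[symmetric] matrix_inv_mult invertible)
  then have inv_R: "invertible R" using invertible_left_inverse by blast
  have "matrix_inv ?Q = matrix_inv R ** matrix_inv R"
  proof (rule matrix_inv_unique)
    have "?Q ** (matrix_inv R ** matrix_inv R) = R ** (R ** matrix_inv R) ** matrix_inv R"
      by (simp only: RR[symmetric] matrix_mul_assoc)
    then show "?Q ** (matrix_inv R ** matrix_inv R) = mat 1" by (simp add: matrix_inv_mult inv_R)
    have "(matrix_inv R ** matrix_inv R) ** ?Q = matrix_inv R ** (matrix_inv R ** R) ** R"
      by (simp only: RR[symmetric] matrix_mul_assoc)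
    then show "(matrix_inv R ** matrix_inv R) ** ?Q = mat 1" by (simp add: matrix_inv_mult inv_R)
  qed
  moreover have "transpose (matrix_inv R) = matrix_inv R"
    by (simp add: transpose_matrix_inv inv_R sym)
  ultimately have "info_matrix C Sx Su *v y = transpose C *v (transpose (matrix_inv R) *v (matrix_inv R *v (C *v y)))"
    by (simp only: info_matrix_def matrix_vector_mul_assoc matrix_mul_assoc)
  then have "y \<bullet> (info_matrix C Sx Su *v y) = (matrix_inv R *v (C *v y)) \<bullet> (matrix_inv R *v (C *v y))"
    by (metis dot_lmul_matrix inner_commute transpose_matrix_vector)
  then show ?thesis by (simp add: dot_square_norm)
qed

end

section \<open>Weighted expectations and the Kushner--Stratonovich functionals\<close>

text \<open>The entries may lie in any Euclidean space, so applying the rule twice reduces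
  matrix-valued functions to their scalar entries.\<close>

lemma integrable_vec:
  fixes g :: "'a \<Rightarrow> 'b::euclidean_space^'n::finite"
  assumes "\<And>k. integrable M (\<lambda>x. g x $ k)"
  shows "integrable M g"
proof -
  have "linear (axis k :: 'b \<Rightarrow> 'b^'n)" for k
    by (rule linearI) (simp_all add: axis_def vec_eq_iff)
  then have "integrable M (\<lambda>x. axis k (g x $ k))" for k
    by (rule integrable_bounded_linear[OF _ assms, OF linear_conv_bounded_linear[THEN iffD1]])
  then have "integrable M (\<lambda>x. \<Sum>k\<in>UNIV. axis k (g x $ k))"
    by (rule Bochner_Integration.integrable_sum)
  also have "(\<lambda>x. \<Sum>k\<in>UNIV. axis k (g x $ k)) = g"
    by (simp add: fun_eq_iff vec_eq_iff axis_def sum.delta)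
  finally show ?thesis .
qed

lemma expect_bounded_linear:
  assumes "bounded_linear h" "integrable lborel (\<lambda>x. q x *\<^sub>R g x)"
  shows "expect q (\<lambda>x. h (g x)) = h (expect q g)"
proof -
  interpret bounded_linear h by fact
  show ?thesis
    using integral_bounded_linear[OF assms] by (simp add: expect_def scaleR)
qed

lemma integrable_bounded_linear_scaleR:
  assumes "bounded_linear h" "integrable lborel (\<lambda>x. q x *\<^sub>R g x)"
  shows "integrable lborel (\<lambda>x. q x *\<^sub>R h (g x))"
proof -
  interpret bounded_linear h by fact
  show ?thesis
    using integrable_bounded_linear[OF assms] by (simp add: scaleR)
qed

lemma expect_component:
  fixes g :: "real^'n::finite \<Rightarrow> 'b::euclidean_space^'k::finite"
  assumes "integrable lborel (\<lambda>x. q x *\<^sub>R g x)"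
  shows "expect q g $ k = expect q (\<lambda>x. g x $ k)"
  using expect_bounded_linear[OF bounded_linear_vec_nth assms] by simp

lemma expect_add:
  assumes "integrable lborel (\<lambda>x. q x *\<^sub>R g x)" "integrable lborel (\<lambda>x. q x *\<^sub>R h x)"
  shows "expect q (\<lambda>x. g x + h x) = expect q g + expect q h"
  using assms by (simp add: expect_def scaleR_add_right)

lemma expect_perturbed:
  assumes "integrable lborel (\<lambda>x. q x *\<^sub>R g x)" "integrable lborel (\<lambda>x. Z x *\<^sub>R g x)"
  shows "expect (\<lambda>x. q x + \<epsilon> * Z x) g = expect q g + \<epsilon> *\<^sub>R expect Z g"
proof -
  have "expect (\<lambda>x. q x + \<epsilon> * Z x) g = (LINT x|lborel. q x *\<^sub>R g x + \<epsilon> *\<^sub>R (Z x *\<^sub>R g x))"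
    unfolding expect_def by (simp add: scaleR_add_left)
  also have "\<dots> = (LINT x|lborel. q x *\<^sub>R g x) + (LINT x|lborel. \<epsilon> *\<^sub>R (Z x *\<^sub>R g x))"
    by (intro Bochner_Integration.integral_add integrable_scaleR_right assms)
  also have "(LINT x|lborel. \<epsilon> *\<^sub>R (Z x *\<^sub>R g x)) = \<epsilon> *\<^sub>R (LINT x|lborel. Z x *\<^sub>R g x)"
    by (rule integral_scaleR_right)
  finally show ?thesis unfolding expect_def .
qed

text \<open>The part of the gain in front of the constant matrix factor. Working with it keeps the
  second application of the noise functional a matter of matrix rows.\<close>

definition gain_vector where
  "gain_vector Sx f q g = covar q g f + Sx *v expect q (grad g)"

lemma ks_gain_eq: "ks_gain C Sx Su f q g = gain_vector Sx f q g v* (transpose C ** matrix_inv (obs_cov C Sx Su))"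
  by (simp add: ks_gain_def gain_vector_def)

text \<open>Expectations are affine along the perturbation and the covariance contains one product
  of two of them. The gain is thus a quadratic polynomial in \<epsilon>, and its derivative at 0 is
  the linear coefficient.\<close>

lemma deriv_ks_gain:
  fixes C :: "real^'n::finite^'m::finite" and f :: "real^'n \<Rightarrow> real^'n"
  assumes q: "integrable lborel (\<lambda>x. q x *\<^sub>R \<phi> x)" "integrable lborel (\<lambda>x. q x *\<^sub>R f x)"
      "integrable lborel (\<lambda>x. q x *\<^sub>R (\<phi> x *\<^sub>R f x))" "integrable lborel (\<lambda>x. q x *\<^sub>R grad \<phi> x)"
    and Z: "integrable lborel (\<lambda>x. Z x *\<^sub>R \<phi> x)" "integrable lborel (\<lambda>x. Z x *\<^sub>R f x)"
      "integrable lborel (\<lambda>x. Z x *\<^sub>R (\<phi> x *\<^sub>R f x))" "integrable lborel (\<lambda>x. Z x *\<^sub>R grad \<phi> x)"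
  shows "deriv (\<lambda>\<epsilon>. ks_gain C Sx Su f (\<lambda>x. q x + \<epsilon> * Z x) \<phi> $ a) 0 =
    ((expect Z (\<lambda>x. \<phi> x *\<^sub>R f x) - expect Z \<phi> *\<^sub>R expect q f - expect q \<phi> *\<^sub>R expect Z f
      + Sx *v expect Z (grad \<phi>)) v* (transpose C ** matrix_inv (obs_cov C Sx Su))) $ a"
    (is "_ = (?u v* ?G) $ a")
proof -
  have lin: "((u + \<epsilon> *\<^sub>R w - \<delta> *\<^sub>R z) v* ?G) $ a =
      (u v* ?G) $ a + \<epsilon> * (w v* ?G) $ a - \<delta> * (z v* ?G) $ a" for u w z \<epsilon> \<delta>
    unfolding vector_matrix_mult_def vec_lambda_beta vector_add_component vector_minus_component
      vector_scaleR_component real_scaleR_def distrib_left distrib_right left_diff_distrib right_diff_distrib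
      sum.distrib sum_subtractf sum_distrib_left mult.assoc ..
  have quad: "u + \<epsilon> *\<^sub>R u' - (s + \<epsilon> * s') *\<^sub>R (w + \<epsilon> *\<^sub>R w') + (n + \<epsilon> *\<^sub>R n')
      = u - s *\<^sub>R w + n + \<epsilon> *\<^sub>R (u' - s' *\<^sub>R w - s *\<^sub>R w' + n') - (\<epsilon> * \<epsilon>) *\<^sub>R (s' *\<^sub>R w')"
    for u u' w w' n n' :: "real^'n" and s s' \<epsilon>
    by (simp add: vec_eq_iff algebra_simps)
  have exp: "gain_vector Sx f (\<lambda>x. q x + \<epsilon> * Z x) \<phi> =
      gain_vector Sx f q \<phi> + \<epsilon> *\<^sub>R ?u - (\<epsilon> * \<epsilon>) *\<^sub>R (expect Z \<phi> *\<^sub>R expect Z f)" for \<epsilon>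
    unfolding gain_vector_def covar_def expect_perturbed[OF q(1) Z(1)] expect_perturbed[OF q(2) Z(2)]
      expect_perturbed[OF q(3) Z(3)] expect_perturbed[OF q(4) Z(4)]
      matrix_vector_right_distrib matrix_vector_mult_scaleR real_scaleR_def
    by (rule quad)
  have gain: "(\<lambda>\<epsilon>. ks_gain C Sx Su f (\<lambda>x. q x + \<epsilon> * Z x) \<phi> $ a) = (\<lambda>\<epsilon>.
      (gain_vector Sx f q \<phi> v* ?G) $ a + \<epsilon> * (?u v* ?G) $ a - \<epsilon> * \<epsilon> * ((expect Z \<phi> *\<^sub>R expect Z f) v* ?G) $ a)"
    unfolding ks_gain_eq exp lin ..
  have "((\<lambda>\<epsilon>. r + \<epsilon> * s - \<epsilon> * \<epsilon> * t) has_real_derivative s) (at 0)" for r s t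
    by (auto intro!: derivative_eq_intros)
  then show ?thesis unfolding gain by (rule DERIV_imp_deriv)
qed

section \<open>Rows of Jacobians and Hessians, and expectations of trace forms\<close>

lemma jacobian_component:
  fixes f :: "real^'n::finite \<Rightarrow> real^'k::finite"
  assumes "\<And>k. C1 (\<lambda>x. f x $ k)"
  shows "jacobian f (at x) $ k = grad (\<lambda>x. f x $ k) x"
proof -
  let ?D = "\<lambda>k. frechet_derivative (\<lambda>x. f x $ k) (at x)"
  have "(f has_derivative (\<lambda>h. \<chi> k. ?D k h)) (at x)"
    unfolding has_derivative_componentwise_within[of f]
    using C1_differentiable[OF assms]
    by (auto simp: Basis_vec_def inner_axis frechet_derivative_works[symmetric])
  then show ?thesis
    by (simp add: jacobian_def matrix_def grad_def partial_def vec_eq_iff frechet_derivative_at[symmetric])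
qed

text \<open>In \<open>hess\<close> the second index is differentiated first, so gradients of first
  partials are its columns. This is the origin of the transposed Hessian in the gain
  formulas.\<close>

lemma hess_component: "transpose (hess \<phi> x) $ l = grad (partial l \<phi>) x"
  by (simp add: hess_def grad_def transpose_def vec_eq_iff)

lemma bounded_linear_trace_mult: "bounded_linear (\<lambda>A::real^'n::finite^'m::finite. trace (A ** B))"
proof -
  have "linear (\<lambda>A::real^'n::finite^'m::finite. trace (A ** B))"
    by (rule linearI) (simp_all add: matrix_mult_add_distrib trace_add matrix_mult_scaleR trace_scaleR)
  then show ?thesis by (simp add: linear_conv_bounded_linear)
qed

lemma bounded_linear_transpose: "bounded_linear (transpose :: real^'n::finite^'m::finite \<Rightarrow> _)"
proof -
  have "linear (transpose :: real^'n::finite^'m::finite \<Rightarrow> _)"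
    by (rule linearI) (simp_all add: transpose_def vec_eq_iff)
  then show ?thesis by (simp add: linear_conv_bounded_linear)
qed

lemma covariance_matrix_mult_commute: "covariance_matrix S \<Longrightarrow> S *v x = x v* S"
  by (metis covariance_matrix_def vector_transpose_matrix)

text \<open>The generator depends on the test function linearly through the matrices
  \<open>outer (f x) (grad \<phi> x)\<close> and \<open>hess \<phi> x\<close>; the expectation
  passes to these, the other matrices being constant.\<close>

lemma expect_modified_generator:
  assumes D: "integrable lborel (\<lambda>x. q x *\<^sub>R outer (f x) (grad \<phi> x))"
    and H: "integrable lborel (\<lambda>x. q x *\<^sub>R hess \<phi> x)"
  shows "expect q (modified_generator C Sx Su f \<phi>) =
      trace (expect q (\<lambda>x. outer (f x) (grad \<phi> x)) ** attenuation C Sx Su)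
      + 1/2 * trace (expect q (hess \<phi>) ** (attenuation C Sx Su ** Sx))"
    and "integrable lborel (\<lambda>x. q x * modified_generator C Sx Su f \<phi> x)"
proof -
  let ?K = "attenuation C Sx Su"
  note lin = bounded_linear_trace_mult
    bounded_linear_compose[OF bounded_linear_mult_right bounded_linear_trace_mult, of "1/2"]
  have eq: "modified_generator C Sx Su f \<phi>
      = (\<lambda>x. trace (outer (f x) (grad \<phi> x) ** ?K) + 1/2 * trace (hess \<phi> x ** (?K ** Sx)))"
    by (simp add: fun_eq_iff modified_generator_def trace_outer_mult matrix_mul_assoc)
  note int = integrable_bounded_linear_scaleR[OF lin(1) D] integrable_bounded_linear_scaleR[OF lin(2) H]
  show "integrable lborel (\<lambda>x. q x * modified_generator C Sx Su f \<phi> x)"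
    unfolding eq distrib_left using Bochner_Integration.integrable_add[OF int] by simp
  show "expect q (modified_generator C Sx Su f \<phi>) =
      trace (expect q (\<lambda>x. outer (f x) (grad \<phi> x)) ** ?K) + 1/2 * trace (expect q (hess \<phi>) ** (?K ** Sx))"
    unfolding eq expect_add[OF int] expect_bounded_linear[OF lin(1) D] expect_bounded_linear[OF lin(2) H] ..
qed

lemma expect_state_generator:
  assumes D: "integrable lborel (\<lambda>x. q x *\<^sub>R outer (f x) (grad \<phi> x))"
    and H: "integrable lborel (\<lambda>x. q x *\<^sub>R hess \<phi> x)"
  shows "expect q (state_generator Sx f \<phi>) =
    trace (expect q (\<lambda>x. outer (f x) (grad \<phi> x))) + 1/2 * trace (expect q (hess \<phi>) ** Sx)"
proof -
  \<comment> \<open>The drift part is the trace of the outer product; the factor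
    \<open>mat 1\<close> puts it into the form of \<open>bounded_linear_trace_mult\<close>.\<close>
  note lin = bounded_linear_trace_mult[where B="mat 1"]
    bounded_linear_compose[OF bounded_linear_mult_right bounded_linear_trace_mult, of "1/2"]
  have eq: "state_generator Sx f \<phi>
      = (\<lambda>x. trace (outer (f x) (grad \<phi> x) ** mat 1) + 1/2 * trace (hess \<phi> x ** Sx))"
    by (simp add: fun_eq_iff state_generator_def trace_outer)
  note int = integrable_bounded_linear_scaleR[OF lin(1) D] integrable_bounded_linear_scaleR[OF lin(2) H]
  show ?thesis
    unfolding eq expect_add[OF int] expect_bounded_linear[OF lin(1) D] expect_bounded_linear[OF lin(2) H]
    by simp
qed

lemma expect_quadratic_form:
  assumes "integrable lborel (\<lambda>x. q x *\<^sub>R (\<phi> x *\<^sub>R outer (f x) (f x)))"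
  shows "expect q (\<lambda>x. \<phi> x * (f x \<bullet> (B *v f x))) = trace (expect q (\<lambda>x. \<phi> x *\<^sub>R outer (f x) (f x)) ** B)"
    and "integrable lborel (\<lambda>x. q x * (\<phi> x * (f x \<bullet> (B *v f x))))"
  using expect_bounded_linear[OF bounded_linear_trace_mult[of B] assms]
    integrable_bounded_linear_scaleR[OF bounded_linear_trace_mult[of B] assms]
  unfolding matrix_mult_scaleR trace_scaleR trace_outer_mult real_scaleR_def .

lemma expect_mult_trace:
  assumes "integrable lborel (\<lambda>x. q x *\<^sub>R (\<phi> x *\<^sub>R A x))"
  shows "expect q (\<lambda>x. \<phi> x * trace (A x ** B)) = trace (expect q (\<lambda>x. \<phi> x *\<^sub>R A x) ** B)"
    and "integrable lborel (\<lambda>x. q x * (\<phi> x * trace (A x ** B)))"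
  using expect_bounded_linear[OF bounded_linear_trace_mult[of B] assms]
    integrable_bounded_linear_scaleR[OF bounded_linear_trace_mult[of B] assms]
  unfolding matrix_mult_scaleR trace_scaleR real_scaleR_def .

section \<open>The Stratonovich drift at compactly supported test functions\<close>

lemma integral_noise:
  assumes form: "stratonovich_density_form C Sx Su f q Ap Bp"
    and \<phi>: "C1 \<phi>" "compactly_supported \<phi>"
  shows "integrable lborel (\<lambda>x. \<phi> x * Bp x $ a)"
    and "(LINT x|lborel. \<phi> x * Bp x $ a) =
      (gain_vector Sx f q \<phi> v* (transpose C ** matrix_inv (obs_cov C Sx Su))) $ a"
  using assms by (auto simp: stratonovich_density_form_def ks_gain_eq)

lemma integrable_f_noise:
  assumes "stratonovich_density_form C Sx Su f q Ap Bp"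
  shows "integrable lborel (\<lambda>x. f x $ k * Bp x $ a)"
  using assms by (auto simp: stratonovich_density_form_def)

section \<open>Integrability of the terms produced by a compactly supported test function\<close>

context
  fixes f :: "real^'n::finite \<Rightarrow> real^'n" and q \<phi> :: "real^'n \<Rightarrow> real"
  assumes f: "\<And>k. C1 (\<lambda>x. f x $ k)"
    and q: "integrable lborel q" "\<And>k. integrable lborel (\<lambda>x. q x * f x $ k)"
    and \<phi>: "C2 \<phi>" "compactly_supported \<phi>"
begin

lemma compactly_supported_terms:
  "compactly_supported (\<lambda>x. \<phi> x * g x)" "compactly_supported (\<lambda>x. partial i \<phi> x * g x)"
  "compactly_supported (partial i \<phi>)" "compactly_supported (partial i (partial j \<phi>))"
  using compactly_supported_mult compactly_supported_partial \<phi>(2) by blast+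

lemma continuous_terms:
  "continuous_on UNIV \<phi>" "continuous_on UNIV (partial i \<phi>)" "continuous_on UNIV (partial i (partial j \<phi>))"
  "continuous_on UNIV (\<lambda>x. f x $ k)" "continuous_on UNIV (partial i (\<lambda>x. f x $ k))"
proof -
  note C1 = C2_imp_C1[OF \<phi>(1)] C2_imp_C1_partial[OF \<phi>(1)]
  show "continuous_on UNIV \<phi>" "continuous_on UNIV (partial i \<phi>)" "continuous_on UNIV (partial i (partial j \<phi>))"
    by (rule C1_continuous C1_continuous_partial, rule C1)+
  show "continuous_on UNIV (\<lambda>x. f x $ k)" "continuous_on UNIV (partial i (\<lambda>x. f x $ k))"
    by (rule C1_continuous[OF f] C1_continuous_partial[OF f])+
qed

text \<open>The moment of \<open>f\<close> is assumed. Every other integrand is \<open>q\<close>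
  times a function whose entries are continuous with compact support.\<close>

lemma integrable_terms:
  "integrable lborel (\<lambda>x. q x *\<^sub>R \<phi> x)"
  "integrable lborel (\<lambda>x. q x *\<^sub>R f x)"
  "integrable lborel (\<lambda>x. q x *\<^sub>R (\<phi> x *\<^sub>R f x))"
  "integrable lborel (\<lambda>x. q x *\<^sub>R grad \<phi> x)"
  "integrable lborel (\<lambda>x. q x *\<^sub>R (\<phi> x *\<^sub>R outer (f x) (f x)))"
  "integrable lborel (\<lambda>x. q x *\<^sub>R outer (f x) (grad \<phi> x))"
  "integrable lborel (\<lambda>x. q x *\<^sub>R (\<phi> x *\<^sub>R jacobian f (at x)))"
  "integrable lborel (\<lambda>x. q x *\<^sub>R hess \<phi> x)"
proof -
  note I = integrable_mult_compactly_supported[OF q(1)]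
  have \<phi>_mult: "integrable lborel (\<lambda>x. q x * (\<phi> x * g x))" if "continuous_on UNIV g" for g
    by (rule I[OF continuous_on_mult[OF continuous_terms(1) that] compactly_supported_terms(1)])
  have partial_mult: "integrable lborel (\<lambda>x. q x * (g x * partial i \<phi> x))" if "continuous_on UNIV g" for g i
    using I[OF continuous_on_mult[OF continuous_terms(2) that] compactly_supported_terms(2), of i] by (simp add: mult_ac)
  show "integrable lborel (\<lambda>x. q x *\<^sub>R \<phi> x)" using I[OF continuous_terms(1) \<phi>(2)] by simp
  show "integrable lborel (\<lambda>x. q x *\<^sub>R f x)" by (rule integrable_vec) (use q in simp)
  show "integrable lborel (\<lambda>x. q x *\<^sub>R (\<phi> x *\<^sub>R f x))"
    by (rule integrable_vec) (use \<phi>_mult[OF continuous_terms(4)] in \<open>simp add: mult.assoc\<close>)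
  show "integrable lborel (\<lambda>x. q x *\<^sub>R grad \<phi> x)"
    by (rule integrable_vec) (use I[OF continuous_terms(2) compactly_supported_terms(3)] in \<open>simp add: grad_def\<close>)
  show "integrable lborel (\<lambda>x. q x *\<^sub>R (\<phi> x *\<^sub>R outer (f x) (f x)))"
    by (rule integrable_vec, rule integrable_vec)
      (use \<phi>_mult[OF continuous_on_mult[OF continuous_terms(4) continuous_terms(4)]] in \<open>simp add: mult.assoc\<close>)
  show "integrable lborel (\<lambda>x. q x *\<^sub>R outer (f x) (grad \<phi> x))"
    by (rule integrable_vec, rule integrable_vec) (use partial_mult[OF continuous_terms(4)] in \<open>simp add: grad_def mult.assoc\<close>)
  show "integrable lborel (\<lambda>x. q x *\<^sub>R (\<phi> x *\<^sub>R jacobian f (at x)))"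
    by (rule integrable_vec, rule integrable_vec)
      (use \<phi>_mult[OF continuous_terms(5)] in \<open>simp add: jacobian_component[OF f] grad_def mult.assoc\<close>)
  show "integrable lborel (\<lambda>x. q x *\<^sub>R hess \<phi> x)"
    by (rule integrable_vec, rule integrable_vec) (use I[OF continuous_terms(3) compactly_supported_terms(4)] in \<open>simp add: hess_def\<close>)
qed

end

section \<open>The Ito correction and the resulting weak form of the drift\<close>

context
  fixes C :: "real^'n::finite^'m::finite" and Sx :: "real^'n^'n" and Su :: "real^'m^'m"
    and f :: "real^'n \<Rightarrow> real^'n" and q Ap \<phi> :: "real^'n \<Rightarrow> real" and Bp :: "real^'n \<Rightarrow> real^'m"
  assumes C: "invertible C" and Sx: "covariance_matrix Sx" and Su: "covariance_matrix Su"
    and Q: "invertible (obs_cov C Sx Su)"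
    and f: "\<And>k. C1 (\<lambda>x. f x $ k)"
    and q: "integrable lborel q" "\<And>k. integrable lborel (\<lambda>x. q x * f x $ k)"
    and form: "stratonovich_density_form C Sx Su f q Ap Bp"
    and \<phi>: "C2 \<phi>" "compactly_supported \<phi>"
begin

private lemmas cs_terms = compactly_supported_terms[OF f q \<phi>]
private lemmas int_terms = integrable_terms[OF f q \<phi>]

private abbreviation (input) "P \<equiv> info_matrix C Sx Su"
private abbreviation (input) "G \<equiv> transpose C ** matrix_inv (obs_cov C Sx Su)"
private abbreviation (input) "Ef \<equiv> expect q f"
private abbreviation (input) "E\<phi>f \<equiv> expect q (\<lambda>x. \<phi> x *\<^sub>R f x)"
private abbreviation (input) "v \<equiv> gain_vector Sx f q \<phi>"
private abbreviation (input) "E\<phi>ff \<equiv> expect q (\<lambda>x. \<phi> x *\<^sub>R outer (f x) (f x))"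
private abbreviation (input) "Efd\<phi> \<equiv> expect q (\<lambda>x. outer (f x) (grad \<phi> x))"
private abbreviation (input) "E\<phi>J \<equiv> expect q (\<lambda>x. \<phi> x *\<^sub>R jacobian f (at x))"
private abbreviation (input) "EH\<phi> \<equiv> expect q (hess \<phi>)"

text \<open>These test functions appear when the noise functional is applied a second time. The
  product rule makes the gradient row \<open>k\<close> of \<phi> times the Jacobian plus an outer
  product, so all \<open>k\<close> fit into one matrix.\<close>

lemma gain_vector_mult_f:
  "gain_vector Sx f q (\<lambda>x. \<phi> x * f x $ k) = (E\<phi>ff - outer E\<phi>f Ef + (E\<phi>J + Efd\<phi>) ** Sx) $ k"
proof -
  have 1: "expect q (\<lambda>x. (\<phi> x * f x $ k) *\<^sub>R f x) = E\<phi>ff $ k"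
    unfolding expect_component[OF int_terms(5)] by simp
  have 2: "expect q (\<lambda>x. \<phi> x * f x $ k) = E\<phi>f $ k"
    unfolding expect_component[OF int_terms(3)] by simp
  have "grad (\<lambda>x. \<phi> x * f x $ k) = (\<lambda>x. (\<phi> x *\<^sub>R jacobian f (at x) + outer (f x) (grad \<phi> x)) $ k)"
    unfolding grad_def partial_mult_C1[OF C2_imp_C1[OF \<phi>(1)] f]
    by (simp add: jacobian_component[OF f] fun_eq_iff vec_eq_iff grad_def mult.commute)
  then have "expect q (grad (\<lambda>x. \<phi> x * f x $ k))
      = expect q (\<lambda>x. \<phi> x *\<^sub>R jacobian f (at x) + outer (f x) (grad \<phi> x)) $ k"
    using int_terms(6,7) by (subst expect_component) (simp_all only: scaleR_add_right Bochner_Integration.integrable_add)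
  also have "\<dots> = (E\<phi>J + Efd\<phi>) $ k"
    by (subst expect_add[OF int_terms(7,6)]) (rule refl)
  finally have 3: "Sx *v expect q (grad (\<lambda>x. \<phi> x * f x $ k)) = ((E\<phi>J + Efd\<phi>) ** Sx) $ k"
    by (simp only: covariance_matrix_mult_commute[OF Sx] matrix_mult_component)
  show ?thesis
    unfolding gain_vector_def covar_def 1 2 3 by simp
qed

lemma gain_vector_partial:
  "gain_vector Sx f q (partial l \<phi>) = (transpose Efd\<phi> - outer (expect q (grad \<phi>)) Ef + transpose EH\<phi> ** Sx) $ l"
proof -
  have tr: "transpose Efd\<phi> = expect q (\<lambda>x. outer (grad \<phi> x) (f x))"
    using expect_bounded_linear[OF bounded_linear_transpose int_terms(6)] by simp
  have i: "integrable lborel (\<lambda>x. q x *\<^sub>R outer (grad \<phi> x) (f x))"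
    using integrable_bounded_linear_scaleR[OF bounded_linear_transpose int_terms(6)] by simp
  have 1: "expect q (\<lambda>x. partial l \<phi> x *\<^sub>R f x) = transpose Efd\<phi> $ l"
    unfolding tr expect_component[OF i] by (simp add: grad_def)
  have 2: "expect q (partial l \<phi>) = expect q (grad \<phi>) $ l"
    unfolding expect_component[OF int_terms(4)] by (simp add: grad_def)
  have "expect q (grad (partial l \<phi>)) = expect q (\<lambda>x. transpose (hess \<phi> x) $ l)"
    by (simp add: hess_component)
  also have "\<dots> = transpose EH\<phi> $ l"
    using expect_component[OF integrable_bounded_linear_scaleR[OF bounded_linear_transpose int_terms(8)]]
    by (simp add: expect_bounded_linear[OF bounded_linear_transpose int_terms(8)])
  finally have 3: "Sx *v expect q (grad (partial l \<phi>)) = (transpose EH\<phi> ** Sx) $ l"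
    by (simp only: covariance_matrix_mult_commute[OF Sx] matrix_mult_component)
  show ?thesis
    unfolding gain_vector_def covar_def 1 2 3 by simp
qed

text \<open>The noise functional at the components of \<open>f\<close>. They need not have compact
  support, so the density equations do not evaluate it; it enters only multiplied by
  \<open>expect q \<phi>\<close>, which is zero for a score.\<close>

private abbreviation (input) "\<beta> \<equiv> (\<chi> k b. LINT x|lborel. f x $ k * Bp x $ b) :: real^'m^'n"

text \<open>The derivative of the gain vector along the noise directions, up to the factor
  \<open>G\<close> on the right and without the \<beta> term.\<close>

private abbreviation (input) "X \<equiv> E\<phi>ff - outer E\<phi>f Ef + (E\<phi>J + Efd\<phi>) ** Sx - outer Ef v
        + Sx ** (transpose Efd\<phi> - outer (expect q (grad \<phi>)) Ef + transpose EH\<phi> ** Sx)"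

lemma integrable_noise_terms:
  "integrable lborel (\<lambda>x. Bp x $ b *\<^sub>R \<phi> x)"
  "integrable lborel (\<lambda>x. Bp x $ b *\<^sub>R f x)"
  "integrable lborel (\<lambda>x. Bp x $ b *\<^sub>R (\<phi> x *\<^sub>R f x))"
  "integrable lborel (\<lambda>x. Bp x $ b *\<^sub>R grad \<phi> x)"
proof -
  note C1 = C2_imp_C1[OF \<phi>(1)] C2_imp_C1_partial[OF \<phi>(1)]
  show "integrable lborel (\<lambda>x. Bp x $ b *\<^sub>R \<phi> x)"
    using integral_noise(1)[OF form C1(1) \<phi>(2), of b] by (simp add: mult.commute)
  show "integrable lborel (\<lambda>x. Bp x $ b *\<^sub>R f x)"
    by (rule integrable_vec) (use integrable_f_noise[OF form] in \<open>simp add: mult.commute\<close>)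
  show "integrable lborel (\<lambda>x. Bp x $ b *\<^sub>R (\<phi> x *\<^sub>R f x))"
    by (rule integrable_vec)
      (use integral_noise(1)[OF form C1_mult[OF C1(1) f] cs_terms(1)] in \<open>simp add: mult_ac\<close>)
  show "integrable lborel (\<lambda>x. Bp x $ b *\<^sub>R grad \<phi> x)"
    by (rule integrable_vec)
      (use integral_noise(1)[OF form C1(2) cs_terms(3)] in \<open>simp add: mult.commute grad_def\<close>)
qed

text \<open>The derivative applies the noise functional to \<open>\<phi> x * f x $ k\<close>,
  \<phi>, \<open>f\<close> and the partials of \<phi>. All but \<open>f\<close> are
  \<open>C1\<close> with compact support, so the gain formula evaluates them again. The products and
  partials are only known to be \<open>C1\<close>, whence the use of the noise identity for that
  class.\<close>

lemma noise_derivative: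
  "deriv (\<lambda>\<epsilon>. ks_gain C Sx Su f (\<lambda>x. q x + \<epsilon> * Bp x $ b) \<phi> $ a) 0 =
    ((\<chi> k. (X ** G - expect q \<phi> *\<^sub>R \<beta>) $ k $ b) v* G) $ a"
proof -
  note C1 = C2_imp_C1[OF \<phi>(1)] C2_imp_C1_partial[OF \<phi>(1)]
  have 1: "expect (\<lambda>x. Bp x $ b) (\<lambda>x. \<phi> x *\<^sub>R f x) $ k = ((E\<phi>ff - outer E\<phi>f Ef + (E\<phi>J + Efd\<phi>) ** Sx) ** G) $ k $ b" for k
    unfolding expect_component[OF integrable_noise_terms(3)] matrix_mult_component gain_vector_mult_f[symmetric]
      integral_noise(2)[OF form C1_mult[OF C1(1) f] cs_terms(1), symmetric]
    by (simp add: expect_def mult.commute)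
  have 2: "expect (\<lambda>x. Bp x $ b) \<phi> = (v v* G) $ b"
    unfolding integral_noise(2)[OF form C1(1) \<phi>(2), symmetric] by (simp add: expect_def mult.commute)
  have 3: "expect (\<lambda>x. Bp x $ b) f $ k = \<beta> $ k $ b" for k
    unfolding expect_component[OF integrable_noise_terms(2)] by (simp add: expect_def mult.commute)
  have 4: "expect (\<lambda>x. Bp x $ b) (grad \<phi>) $ l
      = ((transpose Efd\<phi> - outer (expect q (grad \<phi>)) Ef + transpose EH\<phi> ** Sx) ** G) $ l $ b" for l
    unfolding expect_component[OF integrable_noise_terms(4)] matrix_mult_component gain_vector_partial[symmetric]
      integral_noise(2)[OF form C1(2) cs_terms(3), symmetric]
    by (simp add: expect_def mult.commute grad_def)
  have outer_G: "(outer Ef v ** G) $ k $ b = (v v* G) $ b * Ef $ k" for k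
    by (simp add: matrix_mult_component vector_matrix_mult_def sum_distrib_left mult_ac)
  have mult_4: "(Sx *v expect (\<lambda>x. Bp x $ b) (grad \<phi>)) $ k
      = (Sx ** (transpose Efd\<phi> - outer (expect q (grad \<phi>)) Ef + transpose EH\<phi> ** Sx) ** G) $ k $ b" for k
    unfolding matrix_mul_assoc[symmetric, of Sx _ G] matrix_vector_mult_def
    unfolding matrix_matrix_mult_def[of Sx "_ ** G"] vec_lambda_beta 4 ..
  have "expect (\<lambda>x. Bp x $ b) (\<lambda>x. \<phi> x *\<^sub>R f x) - expect (\<lambda>x. Bp x $ b) \<phi> *\<^sub>R Ef
      - expect q \<phi> *\<^sub>R expect (\<lambda>x. Bp x $ b) f + Sx *v expect (\<lambda>x. Bp x $ b) (grad \<phi>)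
    = (\<chi> k. (X ** G - expect q \<phi> *\<^sub>R \<beta>) $ k $ b)"
    unfolding vec_eq_iff
    unfolding matrix_mult_add_distrib(2)[of _ "Sx ** _" G] matrix_mult_diff_distrib(2)[of _ "outer Ef _" G]
    by (simp only: vec_lambda_beta vector_add_component vector_minus_component vector_scaleR_component 
        1 2 3 outer_G mult_4 real_scaleR_def) simp
  then show ?thesis
    unfolding deriv_ks_gain[OF int_terms(1-4) integrable_noise_terms] by (simp only:)
qed


text \<open>Contraction with the observation covariance makes the Ito correction a trace against
  \<open>P\<close>. After the attenuation identity, everything beyond the filter terms is a multiple
  of \<open>expect q \<phi>\<close>.\<close>

lemma stratonovich_drift_weak_form:
  "integrable lborel (\<lambda>x. \<phi> x * Ap x)"
  "(LINT x|lborel. \<phi> x * Ap x) =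
    expect q (modified_generator C Sx Su f \<phi>)
    - 1/2 * (expect q (\<lambda>x. \<phi> x * (f x \<bullet> (P *v f x)))
             + expect q (\<lambda>x. \<phi> x * trace (jacobian f (at x) ** (Sx ** P))))
    + 1/2 * (Ef \<bullet> (P *v Ef) + trace (C ** \<beta>)) * expect q \<phi>"
proof -
  show "integrable lborel (\<lambda>x. \<phi> x * Ap x)"
    using form \<phi> by (auto simp: stratonovich_density_form_def)
  have GQ: "G ** obs_cov C Sx Su = transpose C"
    by (simp add: matrix_mul_assoc[symmetric] matrix_inv_mult(1)[OF Q])
  have sP: "transpose P = P" and sSx: "transpose Sx = Sx"
    using transpose_info_matrix[OF Sx Su Q] Sx by (auto simp: covariance_matrix_def)
  have "(\<Sum>a\<in>UNIV. \<Sum>b\<in>UNIV. obs_cov C Sx Su $ a $ b *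
         deriv (\<lambda>\<epsilon>. ks_gain C Sx Su f (\<lambda>x. q x + \<epsilon> * Bp x $ b) \<phi> $ a) 0)
    = trace (C ** (X ** G - expect q \<phi> *\<^sub>R \<beta>))"
    unfolding noise_derivative by (rule sum_weighted_gain_eq_trace[OF GQ])
  also have "\<dots> = trace (C ** (X ** G)) - expect q \<phi> * trace (C ** \<beta>)"
    by (simp only: matrix_mult_diff_distrib trace_sub matrix_mult_scaleR trace_scaleR)
  also have "trace (C ** (X ** G)) = trace (X ** P)"
    unfolding info_matrix_def by (subst trace_mul_sym) (simp only: matrix_mul_assoc)
  also have "trace (X ** P) = trace (E\<phi>ff ** P) + trace (E\<phi>J ** Sx ** P) + 2 * trace (Efd\<phi> ** Sx ** P)
      + trace (EH\<phi> ** Sx ** P ** Sx) - 2 * (v \<bullet> (P *v Ef)) - expect q \<phi> * (Ef \<bullet> (P *v Ef))"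
    by (rule trace_correction_terms[OF sP sSx]) (simp add: gain_vector_def covar_def)
  finally have correction: "(\<Sum>a\<in>UNIV. \<Sum>b\<in>UNIV. obs_cov C Sx Su $ a $ b *
         deriv (\<lambda>\<epsilon>. ks_gain C Sx Su f (\<lambda>x. q x + \<epsilon> * Bp x $ b) \<phi> $ a) 0)
    = trace (E\<phi>ff ** P) + trace (E\<phi>J ** Sx ** P) + 2 * trace (Efd\<phi> ** Sx ** P)
      + trace (EH\<phi> ** Sx ** P ** Sx) - 2 * (v \<bullet> (P *v Ef)) - expect q \<phi> * (Ef \<bullet> (P *v Ef))
      - expect q \<phi> * trace (C ** \<beta>)" .
  have gain: "ks_gain C Sx Su f q \<phi> \<bullet> (C *v Ef) = v \<bullet> (P *v Ef)"
    unfolding ks_gain_eq dot_lmul_matrix info_matrix_def by (simp only: matrix_vector_mul_assoc matrix_mul_assoc)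
  \<comment> \<open>Half of the doubled mixed trace, and half of the Hessian trace in
    \<open>HK\<close>, are what separates the state generator from the modified one.\<close>
  have DK: "trace (Efd\<phi> ** attenuation C Sx Su) = trace Efd\<phi> - trace (Efd\<phi> ** Sx ** P)"
    unfolding attenuation_eq[OF Sx Su Q C] matrix_mult_diff_distrib trace_sub by (simp add: matrix_mul_assoc)
  have HK: "trace (EH\<phi> ** (attenuation C Sx Su ** Sx)) = trace (EH\<phi> ** Sx) - trace (EH\<phi> ** Sx ** P ** Sx)"
    unfolding attenuation_eq[OF Sx Su Q C] matrix_mult_diff_distrib trace_sub by (simp add: matrix_mul_assoc)
  have "(LINT x|lborel. \<phi> x * Ap x) = ks_stratonovich_drift C Sx Su f q Bp \<phi>"
    using form \<phi> by (auto simp: stratonovich_density_form_def)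
  also have "\<dots> = (trace Efd\<phi> + 1/2 * trace (EH\<phi> ** Sx) - v \<bullet> (P *v Ef))
      - 1/2 * (trace (E\<phi>ff ** P) + trace (E\<phi>J ** Sx ** P) + 2 * trace (Efd\<phi> ** Sx ** P)
      + trace (EH\<phi> ** Sx ** P ** Sx) - 2 * (v \<bullet> (P *v Ef)) - expect q \<phi> * (Ef \<bullet> (P *v Ef))
      - expect q \<phi> * trace (C ** \<beta>))"
    unfolding ks_stratonovich_drift_def ks_drift_def correction gain expect_state_generator[OF int_terms(6,8)] ..
  \<comment> \<open>Minus one half of the -2 in the correction restores the term in \<open>v\<close>
    that the Ito drift subtracts, so \<open>v\<close> disappears.\<close>
  also have "\<dots> = expect q (modified_generator C Sx Su f \<phi>)
    - 1/2 * (expect q (\<lambda>x. \<phi> x * (f x \<bullet> (P *v f x)))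
             + expect q (\<lambda>x. \<phi> x * trace (jacobian f (at x) ** (Sx ** P))))
    + 1/2 * (Ef \<bullet> (P *v Ef) + trace (C ** \<beta>)) * expect q \<phi>"
    unfolding expect_modified_generator(1)[OF int_terms(6,8)]
      expect_quadratic_form(1)[OF int_terms(5)] expect_mult_trace(1)[OF int_terms(7)] DK HK
    by (simp only: matrix_mul_assoc) algebra
  finally show "(LINT x|lborel. \<phi> x * Ap x) = expect q (modified_generator C Sx Su f \<phi>)
    - 1/2 * (expect q (\<lambda>x. \<phi> x * (f x \<bullet> (P *v f x)))
             + expect q (\<lambda>x. \<phi> x * trace (jacobian f (at x) ** (Sx ** P))))
    + 1/2 * (Ef \<bullet> (P *v Ef) + trace (C ** \<beta>)) * expect q \<phi>" .
qed

end

section \<open>The Stratonovich vector fields at the scores\<close>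

lemma tangent_eq_score:
  assumes "0 < p \<theta> x" "(\<lambda>\<eta>. p \<eta> x) differentiable (at \<theta>)"
  shows "tangent p \<theta> i x = p \<theta> x * score p \<theta> i x"
proof -
  let ?D = "frechet_derivative (\<lambda>\<eta>. p \<eta> x) (at \<theta>)"
  have "((\<lambda>\<eta>. p \<eta> x) has_derivative ?D) (at \<theta>)"
    using assms by (simp add: frechet_derivative_works[symmetric])
  from partial_eqI[OF has_derivative_ln[OF assms(1) this]]
  have "score p \<theta> i x = ?D (axis i 1) * inverse (p \<theta> x)"
    by (simp add: score_def mult.commute)
  then show ?thesis using assms(1) by (simp add: tangent_def partial_def)
qed

lemma regular_family_score:
  assumes family: "regular_family \<Theta> p" and \<theta>: "\<theta> \<in> \<Theta>"
  shows "tangent p \<theta> i x = p \<theta> x * score p \<theta> i x"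
    and "integrable lborel (\<lambda>x. p \<theta> x * score p \<theta> i x)"
    and "(LINT x|lborel. p \<theta> x * score p \<theta> i x) = 0"
proof -
  show t: "tangent p \<theta> i x = p \<theta> x * score p \<theta> i x" for x
    by (rule tangent_eq_score) (use family \<theta> in \<open>auto simp: regular_family_def\<close>)
  \<comment> \<open>The total mass is 1 throughout the open set \<Theta>. Exchanging derivative and
    integral turns this into mean zero of the score.\<close>
  have "((\<lambda>\<eta>. LINT x|lborel. p \<eta> x) has_derivative (\<lambda>_. 0)) (at \<theta>)"
    by (rule has_derivative_transform_within_open[where f="\<lambda>_. 1" and s=\<Theta>])
      (use family \<theta> in \<open>auto simp: regular_family_def\<close>)
  then have "partial i (\<lambda>\<eta>. LINT x|lborel. p \<eta> x) \<theta> = 0" by (rule partial_eqI)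
  then show "integrable lborel (\<lambda>x. p \<theta> x * score p \<theta> i x)"
    "(LINT x|lborel. p \<theta> x * score p \<theta> i x) = 0"
    unfolding t[symmetric] using family \<theta> by (auto simp: regular_family_def)
qed

text \<open>With \<open>expect q f\<close> treated as a constant vector, the covariance becomes one
  integral linear in the test function, as \<open>weak_identity_extends\<close> requires.\<close>

lemma gain_vector_eq_expect:
  assumes "integrable lborel (\<lambda>x. q x *\<^sub>R g x)" "integrable lborel (\<lambda>x. q x *\<^sub>R (g x *\<^sub>R f x))"
    "integrable lborel (\<lambda>x. q x *\<^sub>R grad g x)"
  shows "gain_vector Sx f q g = expect q (\<lambda>x. g x *\<^sub>R (f x - expect q f) + Sx *v grad g x)"
    and "integrable lborel (\<lambda>x. q x *\<^sub>R (g x *\<^sub>R (f x - expect q f) + Sx *v grad g x))"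
proof -
  let ?e = "expect q f"
  have 1: "integrable lborel (\<lambda>x. q x *\<^sub>R (g x *\<^sub>R ?e))"
    using integrable_bounded_linear_scaleR[OF bounded_linear_scaleR_left assms(1)] .
  have 2: "integrable lborel (\<lambda>x. q x *\<^sub>R (g x *\<^sub>R (f x - ?e)))"
    using Bochner_Integration.integrable_diff[OF assms(2) 1] by (simp add: scaleR_diff_right)
  have 3: "integrable lborel (\<lambda>x. q x *\<^sub>R (Sx *v grad g x))"
    by (rule integrable_bounded_linear_scaleR[OF matrix_vector_mul_bounded_linear assms(3)])
  show "integrable lborel (\<lambda>x. q x *\<^sub>R (g x *\<^sub>R (f x - ?e) + Sx *v grad g x))"
    unfolding scaleR_add_right by (rule Bochner_Integration.integrable_add[OF 2 3])
  have "expect q (\<lambda>x. g x *\<^sub>R f x) = expect q (\<lambda>x. g x *\<^sub>R (f x - ?e)) + expect q (\<lambda>x. g x *\<^sub>R ?e)"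
    by (subst expect_add[OF 2 1, symmetric]) (simp add: scaleR_diff_right)
  then show "gain_vector Sx f q g = expect q (\<lambda>x. g x *\<^sub>R (f x - ?e) + Sx *v grad g x)"
    unfolding gain_vector_def covar_def expect_add[OF 2 3]
      expect_bounded_linear[OF bounded_linear_scaleR_left assms(1)]
      expect_bounded_linear[OF matrix_vector_mul_bounded_linear assms(3)] by simp
qed

lemma trace_mult_sum: "trace (A ** B) = (\<Sum>i\<in>UNIV. \<Sum>j\<in>UNIV. A $ i $ j * B $ j $ i)"
  for A :: "real^'n::finite^'m::finite"
  by (simp add: trace_def matrix_matrix_mult_def)

section \<open>Extension of the noise and drift identities to scores\<close>

context
  fixes C :: "real^'n::finite^'m::finite" and Sx :: "real^'n^'n" and Su :: "real^'m^'m"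
    and f :: "real^'n \<Rightarrow> real^'n" and q Ap \<psi> :: "real^'n \<Rightarrow> real" and Bp :: "real^'n \<Rightarrow> real^'m"
  assumes C: "invertible C" and Sx: "covariance_matrix Sx" and Su: "covariance_matrix Su"
    and Q: "invertible (obs_cov C Sx Su)"
    and f: "\<And>k. C1 (\<lambda>x. f x $ k)"
    and q: "integrable lborel q"
    and form: "stratonovich_density_form C Sx Su f q Ap Bp"
    and \<psi>: "C2 \<psi>" "integrable lborel (\<lambda>x. q x * \<psi> x)" "(LINT x|lborel. q x * \<psi> x) = 0"
    and moments: "moments_exist f q \<psi>"
begin

lemma moments_integrable:
  "integrable lborel (\<lambda>x. q x * f x $ k)"
  "integrable lborel (\<lambda>x. q x *\<^sub>R f x)"
  "integrable lborel (\<lambda>x. q x *\<^sub>R (\<psi> x *\<^sub>R f x))"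
  "integrable lborel (\<lambda>x. q x *\<^sub>R grad \<psi> x)"
  "integrable lborel (\<lambda>x. q x *\<^sub>R (\<psi> x *\<^sub>R outer (f x) (f x)))"
  "integrable lborel (\<lambda>x. q x *\<^sub>R outer (f x) (grad \<psi> x))"
  "integrable lborel (\<lambda>x. q x *\<^sub>R (\<psi> x *\<^sub>R jacobian f (at x)))"
  "integrable lborel (\<lambda>x. q x *\<^sub>R hess \<psi> x)"
  "integrable lborel (\<lambda>x. q x *\<^sub>R (partial k \<psi> x *\<^sub>R f x))"
  using moments unfolding moments_exist_def
  by - (((rule integrable_vec)+)?, simp add: grad_def hess_def mult_ac)+

text \<open>For compactly supported test functions the noise equation says that a first-order
  operator integrates to zero. The extension to \<psi> applies, and mean zero of \<psi> reduces the
  covariance to an expectation.\<close>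

lemma projected_noise:
  assumes B\<psi>: "integrable lborel (\<lambda>x. \<psi> x * Bp x $ a)"
  shows "(LINT x|lborel. \<psi> x * Bp x $ a) =
    ((expect q (\<lambda>x. \<psi> x *\<^sub>R f x) + Sx *v expect q (grad \<psi>))
      v* (transpose C ** matrix_inv (obs_cov C Sx Su))) $ a"
proof -
  let ?G = "transpose C ** matrix_inv (obs_cov C Sx Su)"
  let ?c = "\<lambda>x. Bp x $ a - q x * ((f x - expect q f) v* ?G) $ a"
    and ?b = "\<lambda>l x. - (q x * (Sx ** ?G) $ l $ a)"
  have lin: "bounded_linear (\<lambda>u::real^'n. (u v* ?G) $ a)"
    \<comment> \<open>Multiplying a row vector by a matrix is multiplying a column vector by its
      transpose.\<close>
    using bounded_linear_compose[OF bounded_linear_vec_nth matrix_vector_mul_bounded_linear[of "transpose ?G"]]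
    by simp
  have pointwise: "?c x * g x + (\<Sum>l\<in>UNIV. ?b l x * partial l g x)
        + (\<Sum>i\<in>UNIV. \<Sum>j\<in>UNIV. 0 * partial i (partial j g) x)
      = g x * Bp x $ a - q x * ((g x *\<^sub>R (f x - expect q f) + Sx *v grad g x) v* ?G) $ a"
    for g :: "real^'n \<Rightarrow> real" and x
  proof -
    have "((Sx *v grad g x) v* ?G) $ a = (\<Sum>l\<in>UNIV. (Sx ** ?G) $ l $ a * partial l g x)"
      unfolding covariance_matrix_mult_commute[OF Sx] vector_matrix_mul_assoc
      by (simp add: vector_matrix_mult_def grad_def mult.commute)
    moreover have "((g x *\<^sub>R (f x - expect q f)) v* ?G) $ a = g x * ((f x - expect q f) v* ?G) $ a"
      using linear_cmul[OF bounded_linear.linear[OF lin]] by simp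
    ultimately show ?thesis
      by (simp add: vector_matrix_left_distrib left_diff_distrib right_diff_distrib distrib_left sum_negf sum_distrib_left mult_ac)
  qed
  have integral: "(LINT x|lborel. g x * Bp x $ a - q x * ((g x *\<^sub>R (f x - expect q f) + Sx *v grad g x) v* ?G) $ a)
      = (LINT x|lborel. g x * Bp x $ a) - (gain_vector Sx f q g v* ?G) $ a"
    if "integrable lborel (\<lambda>x. g x * Bp x $ a)" "integrable lborel (\<lambda>x. q x *\<^sub>R g x)"
      "integrable lborel (\<lambda>x. q x *\<^sub>R (g x *\<^sub>R f x))" "integrable lborel (\<lambda>x. q x *\<^sub>R grad g x)" for g
  proof -
    note gain = gain_vector_eq_expect[OF that(2-4), of Sx]
    have "(LINT x|lborel. q x * ((g x *\<^sub>R (f x - expect q f) + Sx *v grad g x) v* ?G) $ a)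
        = (gain_vector Sx f q g v* ?G) $ a"
      using expect_bounded_linear[OF lin gain(2)] unfolding gain(1) by (simp add: expect_def)
    then show ?thesis
      using Bochner_Integration.integral_diff[OF that(1)
          integrable_bounded_linear_scaleR[OF lin gain(2), unfolded real_scaleR_def]] by simp
  qed
  have "(LINT x|lborel. ?c x * \<psi> x + (\<Sum>l\<in>UNIV. ?b l x * partial l \<psi> x)
      + (\<Sum>i\<in>UNIV. \<Sum>j\<in>UNIV. 0 * partial i (partial j \<psi>) x)) = 0"
  proof (rule weak_identity_extends[OF \<psi>(1)])
    have "integrable lborel (\<lambda>x. q x *\<^sub>R (\<psi> x *\<^sub>R (f x - expect q f)))"
      using Bochner_Integration.integrable_diff[OF moments_integrable(3)
        integrable_bounded_linear_scaleR[OF bounded_linear_scaleR_left \<psi>(2)[folded real_scaleR_def]]]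
      by (simp add: scaleR_diff_right)
    from integrable_bounded_linear_scaleR[OF lin this]
    have "integrable lborel (\<lambda>x. q x * (\<psi> x * ((f x - expect q f) v* ?G) $ a))"
      using linear_cmul[OF bounded_linear.linear[OF lin]] by simp
    from Bochner_Integration.integrable_diff[OF B\<psi> this]
    show "integrable lborel (\<lambda>x. ?c x * \<psi> x)" by (simp add: algebra_simps)
    show "integrable lborel (\<lambda>x. ?b l x * \<psi> x)" for l
      using integrable_mult_right[OF \<psi>(2), of "- (Sx ** ?G) $ l $ a"] by (simp add: mult_ac)
    have "integrable lborel (\<lambda>x. q x * partial l \<psi> x)" for l
      using moments by (simp add: moments_exist_def)
    from integrable_mult_right[OF this]
    show "integrable lborel (\<lambda>x. ?b l x * partial l \<psi> x)" for l
      using \<open>\<And>l c. integrable lborel (\<lambda>x. c * (q x * partial l \<psi> x))\<close>[of "- (Sx ** ?G) $ l $ a" l]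
      by (simp add: mult_ac)
    fix \<phi> :: "real^'n \<Rightarrow> real" assume \<phi>: "C2 \<phi>" "compactly_supported \<phi>"
    note noise = integral_noise[OF form C2_imp_C1[OF \<phi>(1)] \<phi>(2)]
    note int = integrable_terms[OF f q moments_integrable(1) \<phi>]
    show "(LINT x|lborel. ?c x * \<phi> x + (\<Sum>l\<in>UNIV. ?b l x * partial l \<phi> x)
      + (\<Sum>i\<in>UNIV. \<Sum>j\<in>UNIV. 0 * partial i (partial j \<phi>) x)) = 0"
      unfolding pointwise using integral[OF noise(1) int(1,3,4)] noise(2)[of a] by simp
  qed simp_all
  then have "(LINT x|lborel. \<psi> x * Bp x $ a) = (gain_vector Sx f q \<psi> v* ?G) $ a"
    unfolding pointwise using integral[OF B\<psi> _ moments_integrable(3,4)] \<psi>(2) by simp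
  then show ?thesis using \<psi>(3) by (simp add: gain_vector_def covar_def expect_def)
qed

lemma projected_drift:
  assumes A\<psi>: "integrable lborel (\<lambda>x. \<psi> x * Ap x)"
  shows "(LINT x|lborel. \<psi> x * Ap x) =
    expect q (modified_generator C Sx Su f \<psi>)
    - 1/2 * (expect q (\<lambda>x. \<psi> x * (f x \<bullet> (info_matrix C Sx Su *v f x)))
             + expect q (\<lambda>x. \<psi> x * trace (jacobian f (at x) ** (Sx ** info_matrix C Sx Su))))"
proof -
  let ?P = "info_matrix C Sx Su" and ?K = "attenuation C Sx Su"
  \<comment> \<open>The coefficient of \<open>expect q \<phi>\<close> in the weak form. It does not
    depend on the test function, so it can be absorbed into the zeroth-order coefficient.\<close>
  define \<kappa> where "\<kappa> = 1/2 * (expect q f \<bullet> (?P *v expect q f)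
    + trace (C ** (\<chi> k b. LINT x|lborel. f x $ k * Bp x $ b)))"
  let ?V = "\<lambda>x. f x \<bullet> (?P *v f x)" and ?J = "\<lambda>x. trace (jacobian f (at x) ** (Sx ** ?P))"
  let ?c = "\<lambda>x. Ap x + q x * (1/2 * (?V x + ?J x) - \<kappa>)"
    and ?b = "\<lambda>l x. - (q x * (?K *v f x) $ l)"
    \<comment> \<open>The indices are swapped because the trace of a product pairs entry (i, j) of
      the Hessian with entry (j, i) of the other factor.\<close>
    and ?a = "\<lambda>i j x. - (1/2 * (?K ** Sx) $ j $ i) * q x"
  have pointwise: "?c x * g x + (\<Sum>l\<in>UNIV. ?b l x * partial l g x)
        + (\<Sum>i\<in>UNIV. \<Sum>j\<in>UNIV. ?a i j x * partial i (partial j g) x)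
      = g x * Ap x - q x * modified_generator C Sx Su f g x
        + 1/2 * (q x * (g x * ?V x) + q x * (g x * ?J x)) - \<kappa> * (q x * g x)"
    for g :: "real^'n \<Rightarrow> real" and x
  proof -
    have "(\<Sum>l\<in>UNIV. ?b l x * partial l g x) = - q x * (grad g x \<bullet> (?K *v f x))"
      by (simp add: inner_vec_def grad_def sum_distrib_left sum_negf mult_ac)
    moreover have "(\<Sum>i\<in>UNIV. \<Sum>j\<in>UNIV. ?a i j x * partial i (partial j g) x)
        = - q x * (1/2 * trace (hess g x ** ?K ** Sx))"
      unfolding matrix_mul_assoc[symmetric] trace_mult_sum
      by (simp add: hess_def sum_distrib_left sum_negf mult_ac)
    ultimately show ?thesis by (simp add: modified_generator_def algebra_simps)
  qed
  have integral: "(LINT x|lborel. g x * Ap x - q x * modified_generator C Sx Su f g x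
        + 1/2 * (q x * (g x * ?V x) + q x * (g x * ?J x)) - \<kappa> * (q x * g x))
      = (LINT x|lborel. g x * Ap x) - expect q (modified_generator C Sx Su f g)
        + 1/2 * (expect q (\<lambda>x. g x * ?V x) + expect q (\<lambda>x. g x * ?J x)) - \<kappa> * expect q g"
    if Ag: "integrable lborel (\<lambda>x. g x * Ap x)" and g: "integrable lborel (\<lambda>x. q x * g x)"
      and "integrable lborel (\<lambda>x. q x *\<^sub>R (g x *\<^sub>R outer (f x) (f x)))"
      "integrable lborel (\<lambda>x. q x *\<^sub>R outer (f x) (grad g x))"
      "integrable lborel (\<lambda>x. q x *\<^sub>R (g x *\<^sub>R jacobian f (at x)))"
      "integrable lborel (\<lambda>x. q x *\<^sub>R hess g x)" for g
    using Ag g expect_modified_generator(2)[OF that(4,6), of C Sx Su]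
      expect_quadratic_form(2)[OF that(3), of ?P] expect_mult_trace(2)[OF that(5), of "Sx ** ?P"]
    by (simp add: expect_def)
  have "(LINT x|lborel. ?c x * \<psi> x + (\<Sum>l\<in>UNIV. ?b l x * partial l \<psi> x)
      + (\<Sum>i\<in>UNIV. \<Sum>j\<in>UNIV. ?a i j x * partial i (partial j \<psi>) x)) = 0"
  proof (rule weak_identity_extends[OF \<psi>(1)])
    have "integrable lborel (\<lambda>x. \<psi> x * Ap x + (1/2 * (q x * (\<psi> x * ?V x) + q x * (\<psi> x * ?J x)) - \<kappa> * (q x * \<psi> x)))"
      using A\<psi> \<psi>(2) expect_quadratic_form(2)[OF moments_integrable(5), of ?P]
        expect_mult_trace(2)[OF moments_integrable(7), of "Sx ** ?P"] by simp
    then show "integrable lborel (\<lambda>x. ?c x * \<psi> x)" by (simp add: algebra_simps)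
    have lin: "bounded_linear (\<lambda>u. (?K *v u) $ l)" for l
      by (rule bounded_linear_compose[OF bounded_linear_vec_nth matrix_vector_mul_bounded_linear])
    have "integrable lborel (\<lambda>x. q x * (g x * (?K *v f x) $ l))"
      if "integrable lborel (\<lambda>x. q x *\<^sub>R (g x *\<^sub>R f x))" for g l
      using integrable_bounded_linear_scaleR[OF lin that, of l] by (simp add: matrix_vector_mult_scaleR)
    from Bochner_Integration.integrable_minus[OF this[OF moments_integrable(3)]]
      Bochner_Integration.integrable_minus[OF this[OF moments_integrable(9)]]
    show "integrable lborel (\<lambda>x. ?b l x * \<psi> x)" "integrable lborel (\<lambda>x. ?b l x * partial l \<psi> x)" for l
      by (simp_all add: mult_ac)
    have "integrable lborel (\<lambda>x. q x * partial k \<psi> x)" "integrable lborel (\<lambda>x. q x * partial k (partial l \<psi>) x)"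
      for k l using moments by (simp_all add: moments_exist_def)
    then show "integrable lborel (\<lambda>x. ?a i j x * \<psi> x)" "integrable lborel (\<lambda>x. ?a i j x * partial k \<psi> x)"
      "integrable lborel (\<lambda>x. ?a i j x * partial i (partial j \<psi>) x)" for i j k
      using \<psi>(2) by (simp_all only: mult.assoc integrable_mult_right)
    fix \<phi> :: "real^'n \<Rightarrow> real" assume \<phi>: "C2 \<phi>" "compactly_supported \<phi>"
    note weak = stratonovich_drift_weak_form[OF C Sx Su Q f q moments_integrable(1) form \<phi>]
    note int = integrable_terms[OF f q moments_integrable(1) \<phi>]
    show "(LINT x|lborel. ?c x * \<phi> x + (\<Sum>l\<in>UNIV. ?b l x * partial l \<phi> x)
      + (\<Sum>i\<in>UNIV. \<Sum>j\<in>UNIV. ?a i j x * partial i (partial j \<phi>) x)) = 0"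
      unfolding pointwise integral[OF weak(1) int(1)[unfolded real_scaleR_def] int(5,6,7,8)] weak(2)
      by (simp add: \<kappa>_def algebra_simps)
  qed
  \<comment> \<open>Mean zero of \<psi> removes the \<kappa> term, and with it the unevaluated noise
    moments of \<open>f\<close>.\<close>
  then show ?thesis
    unfolding pointwise integral[OF A\<psi> \<psi>(2) moments_integrable(5,6,7,8)]
    using \<psi>(3) by (simp add: expect_def)
qed

end

section \<open>Dependence of the equation on its coefficients\<close>

text \<open>The trapezoidal sums evaluate the integrand only at partition points, which lie between
  0 and \<open>t\<close>; agreement there gives identical error events.\<close>

lemma stratonovich_integral_cong:
  assumes Y: "\<And>s \<omega>. 0 \<le> s \<Longrightarrow> s \<le> t \<Longrightarrow> \<omega> \<in> space M \<Longrightarrow> Y s \<omega> = Y' s \<omega>"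
  assumes I: "has_stratonovich_integral M Y U t I"
  shows "has_stratonovich_integral M Y' U t I"
proof -
  have meas: "Y s \<in> borel_measurable M \<longleftrightarrow> Y' s \<in> borel_measurable M" if "s \<in> {0..t}" for s
    by (rule measurable_cong) (use Y that in auto)
  let ?err = "\<lambda>Y n \<tau> \<omega>.
    \<bar>(\<Sum>k<n. ((1/2) *\<^sub>R (Y (\<tau> k) \<omega> + Y (\<tau> (Suc k)) \<omega>)) \<bullet> (U (\<tau> (Suc k)) \<omega> - U (\<tau> k) \<omega>)) - I \<omega>\<bar>"
  have err: "{\<omega> \<in> space M. \<epsilon> < ?err Y n \<tau> \<omega>} = {\<omega> \<in> space M. \<epsilon> < ?err Y' n \<tau> \<omega>}"
    if "partition_of t n \<tau>" for \<epsilon> n \<tau>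
  proof -
    have step: "\<tau> k \<le> \<tau> (Suc k)" if "k < n" for k
      using \<open>partition_of t n \<tau>\<close> that by (auto simp: partition_of_def)
    have mono: "\<tau> j \<le> \<tau> k" if "j \<le> k" "k \<le> n" for j k
      using that by (induction rule: dec_induct) (use step order_trans in \<open>force+\<close>)
    have "0 \<le> \<tau> k \<and> \<tau> k \<le> t" if "k \<le> n" for k
      using mono[of 0 k] mono[of k n] that \<open>partition_of t n \<tau>\<close> by (auto simp: partition_of_def)
    then have "?err Y n \<tau> \<omega> = ?err Y' n \<tau> \<omega>" if "\<omega> \<in> space M" for \<omega>
      using that by (intro arg_cong[where f="\<lambda>s. \<bar>s - I \<omega>\<bar>"] sum.cong) (auto simp: Y)
    then show ?thesis by auto
  qed
  have "\<exists>\<delta>>0. \<forall>n \<tau>. partition_of t n \<tau> \<longrightarrow> (\<forall>k<n. \<tau> (Suc k) - \<tau> k < \<delta>) \<longrightarrow>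
      measure M {\<omega> \<in> space M. \<epsilon> < ?err Y' n \<tau> \<omega>} < \<eta>" if "\<epsilon> > 0" "\<eta> > 0" for \<epsilon> \<eta>
  proof -
    from I have "\<forall>\<epsilon>>0. \<forall>\<eta>>0. \<exists>\<delta>>0. \<forall>n \<tau>. partition_of t n \<tau> \<longrightarrow> (\<forall>k<n. \<tau> (Suc k) - \<tau> k < \<delta>) \<longrightarrow>
        measure M {\<omega> \<in> space M. \<epsilon> < ?err Y n \<tau> \<omega>} < \<eta>"
      unfolding has_stratonovich_integral_def by (elim conjE)
    from this[rule_format, OF that] obtain \<delta> where "\<delta> > 0" and
      \<delta>: "\<And>n \<tau>. partition_of t n \<tau> \<longrightarrow> (\<forall>k<n. \<tau> (Suc k) - \<tau> k < \<delta>) \<longrightarrow>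
        measure M {\<omega> \<in> space M. \<epsilon> < ?err Y n \<tau> \<omega>} < \<eta>"
      by blast
    have "partition_of t n \<tau> \<longrightarrow> (\<forall>k<n. \<tau> (Suc k) - \<tau> k < \<delta>) \<longrightarrow>
        measure M {\<omega> \<in> space M. \<epsilon> < ?err Y' n \<tau> \<omega>} < \<eta>" for n \<tau>
      using \<delta>[of n \<tau>] err[of n \<tau> \<epsilon>] by simp
    with \<open>\<delta> > 0\<close> show ?thesis by blast
  qed
  with I meas show ?thesis unfolding has_stratonovich_integral_def by blast
qed

text \<open>A solution stays in \<Theta> at every nonnegative time and every sample point, so the
  equation sees its coefficients only there.\<close>

lemma solves_stratonovich_sde_mono:
  assumes \<mu>: "\<And>\<theta> t. \<theta> \<in> \<Theta> \<Longrightarrow> 0 \<le> t \<Longrightarrow> \<mu> \<theta> t = \<mu>' \<theta> t"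
    and \<sigma>: "\<And>\<theta> t. \<theta> \<in> \<Theta> \<Longrightarrow> 0 \<le> t \<Longrightarrow> \<sigma> \<theta> t = \<sigma>' \<theta> t"
    and sol: "solves_stratonovich_sde M F \<Theta> \<mu> \<sigma> U \<theta>"
  shows "solves_stratonovich_sde M F \<Theta> \<mu>' \<sigma>' U \<theta>"
proof -
  have in_\<Theta>: "\<theta> t \<omega> \<in> \<Theta>" if "0 \<le> t" "\<omega> \<in> space M" for t \<omega>
    using sol that by (auto simp: solves_stratonovich_sde_def)
  have "\<exists>I. has_stratonovich_integral M (\<lambda>s \<omega>. \<sigma>' (\<theta> s \<omega>) s $ j) U t I \<and>
        (AE \<omega> in M. set_integrable lborel {0..t} (\<lambda>s. \<mu>' (\<theta> s \<omega>) s $ j) \<and>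
           \<theta> t \<omega> $ j = \<theta> 0 \<omega> $ j + (LINT s:{0..t}|lborel. \<mu>' (\<theta> s \<omega>) s $ j) + I \<omega>)"
    if "0 \<le> t" for t j
  proof -
    obtain I where I: "has_stratonovich_integral M (\<lambda>s \<omega>. \<sigma> (\<theta> s \<omega>) s $ j) U t I"
      and AE: "AE \<omega> in M. set_integrable lborel {0..t} (\<lambda>s. \<mu> (\<theta> s \<omega>) s $ j) \<and>
           \<theta> t \<omega> $ j = \<theta> 0 \<omega> $ j + (LINT s:{0..t}|lborel. \<mu> (\<theta> s \<omega>) s $ j) + I \<omega>"
      using sol \<open>0 \<le> t\<close> unfolding solves_stratonovich_sde_def by blast
    have "has_stratonovich_integral M (\<lambda>s \<omega>. \<sigma>' (\<theta> s \<omega>) s $ j) U t I"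
      by (rule stratonovich_integral_cong[OF _ I]) (simp add: \<sigma> in_\<Theta>)
    moreover have "AE \<omega> in M. set_integrable lborel {0..t} (\<lambda>s. \<mu>' (\<theta> s \<omega>) s $ j) \<and>
           \<theta> t \<omega> $ j = \<theta> 0 \<omega> $ j + (LINT s:{0..t}|lborel. \<mu>' (\<theta> s \<omega>) s $ j) + I \<omega>"
      using AE
    proof (rule AE_mp, intro AE_I2 impI)
      fix \<omega> assume \<omega>: "\<omega> \<in> space M" and *: "set_integrable lborel {0..t} (\<lambda>s. \<mu> (\<theta> s \<omega>) s $ j) \<and>
           \<theta> t \<omega> $ j = \<theta> 0 \<omega> $ j + (LINT s:{0..t}|lborel. \<mu> (\<theta> s \<omega>) s $ j) + I \<omega>"
      have eq: "(\<lambda>s. indicator {0..t} s *\<^sub>R \<mu> (\<theta> s \<omega>) s $ j) = (\<lambda>s. indicator {0..t} s *\<^sub>R \<mu>' (\<theta> s \<omega>) s $ j)"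
        using in_\<Theta>[OF _ \<omega>] \<mu> by (auto simp: fun_eq_iff indicator_def)
      show "set_integrable lborel {0..t} (\<lambda>s. \<mu>' (\<theta> s \<omega>) s $ j) \<and>
           \<theta> t \<omega> $ j = \<theta> 0 \<omega> $ j + (LINT s:{0..t}|lborel. \<mu>' (\<theta> s \<omega>) s $ j) + I \<omega>"
        using * unfolding set_integrable_def set_lebesgue_integral_def eq .
    qed
    ultimately show ?thesis by blast
  qed
  with sol show ?thesis unfolding solves_stratonovich_sde_def by blast
qed

lemma solves_stratonovich_sde_cong:
  assumes "\<And>\<theta> t. \<theta> \<in> \<Theta> \<Longrightarrow> 0 \<le> t \<Longrightarrow> \<mu> \<theta> t = \<mu>' \<theta> t"
    and "\<And>\<theta> t. \<theta> \<in> \<Theta> \<Longrightarrow> 0 \<le> t \<Longrightarrow> \<sigma> \<theta> t = \<sigma>' \<theta> t"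
  shows "solves_stratonovich_sde M F \<Theta> \<mu> \<sigma> U \<theta> \<longleftrightarrow> solves_stratonovich_sde M F \<Theta> \<mu>' \<sigma>' U \<theta>"
  using assms solves_stratonovich_sde_mono[of \<Theta> \<mu> \<mu>' \<sigma> \<sigma>' M F U \<theta>]
    solves_stratonovich_sde_mono[of \<Theta> \<mu>' \<mu> \<sigma>' \<sigma> M F U \<theta>] by auto

section \<open>The projection filter\<close>

text \<open>The tangent vector is the density times the score, so the Fisher inner product cancels
  the density and leaves the integrals treated by \<open>projected_drift\<close> and
  \<open>projected_noise\<close>.\<close>

lemma projection_eq_explicit:
  fixes p :: "real^'k::finite \<Rightarrow> real^'n::finite \<Rightarrow> real" and C :: "real^'n^'m::finite"
  assumes C: "invertible C" and Sx: "covariance_matrix Sx" and Su: "covariance_matrix Su"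
    and Q: "invertible (obs_cov C Sx Su)" and R: "is_sqrt_of R (obs_cov C Sx Su)"
    and f: "\<And>k. C1 (\<lambda>x. f x t $ k)"
    and family: "regular_family \<Theta> p" and \<theta>: "\<theta> \<in> \<Theta>"
    and moments: "\<And>i. moments_exist (\<lambda>x. f x t) (p \<theta>) (score p \<theta> i)"
    and form: "stratonovich_density_form C Sx Su (\<lambda>x. f x t) (p \<theta>) (A t (p \<theta>)) (B t (p \<theta>))"
    and int_A: "\<And>i. integrable lborel (\<lambda>x. A t (p \<theta>) x * tangent p \<theta> i x / p \<theta> x)"
    and int_B: "\<And>i a. integrable lborel (\<lambda>x. B t (p \<theta>) x $ a * tangent p \<theta> i x / p \<theta> x)"
  shows "projection_drift p A \<theta> t =
      explicit_drift C Sx Su R f p (\<lambda>t. modified_generator C Sx Su (\<lambda>x. f x t)) \<theta> t"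
    and "projection_gain p B \<theta> t = explicit_gain C Sx Su f p \<theta> t"
proof -
  have pos: "0 < p \<theta> x" and q: "integrable lborel (p \<theta>)" and score: "C2 (score p \<theta> i)" for x i
    using family \<theta> by (auto simp: regular_family_def)
  have quot: "Z * tangent p \<theta> i x / p \<theta> x = score p \<theta> i x * Z" for Z i x
    using pos[of x] by (simp add: regular_family_score(1)[OF family \<theta>])
  note proj = C Sx Su Q f q form score regular_family_score(2,3)[OF family \<theta>] moments
  \<comment> \<open>Cyclic rotation collects the outer factors into
    \<open>info_matrix C Sx Su\<close>.\<close>
  have trace_eq: "trace (matrix_inv (obs_cov C Sx Su) ** C ** J ** Sx ** transpose C)
      = trace (J ** (Sx ** info_matrix C Sx Su))" for J
  proof -
    have "trace (matrix_inv (obs_cov C Sx Su) ** C ** J ** Sx ** transpose C)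
        = trace (info_matrix C Sx Su ** (J ** Sx))"
      unfolding info_matrix_def by (subst trace_mul_sym) (simp only: matrix_mul_assoc)
    also have "\<dots> = trace (J ** (Sx ** info_matrix C Sx Su))"
      by (subst trace_mul_sym) (simp only: matrix_mul_assoc)
    finally show ?thesis .
  qed
  have "fisher_inner (p \<theta>) (A t (p \<theta>)) (tangent p \<theta> i) =
      expect (p \<theta>) (modified_generator C Sx Su (\<lambda>x. f x t) (score p \<theta> i))
      - 1/2 * (expect (p \<theta>) (\<lambda>x. (norm (matrix_inv R *v (C *v f x t)))\<^sup>2 * score p \<theta> i x)
          + expect (p \<theta>) (\<lambda>x.
              trace (matrix_inv (obs_cov C Sx Su) ** C ** jacobian (\<lambda>y. f y t) (at x)
                     ** Sx ** transpose C) * score p \<theta> i x))" for i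
    unfolding fisher_inner_def quot projected_drift[OF proj int_A[unfolded quot]]
      norm_matrix_inv_sqrt[OF Sx Su Q R] trace_eq by (simp only: mult.commute)
  then show "projection_drift p A \<theta> t =
      explicit_drift C Sx Su R f p (\<lambda>t. modified_generator C Sx Su (\<lambda>x. f x t)) \<theta> t"
    by (simp only: projection_drift_def projection_coord_def explicit_drift_def)
  have "fisher_inner (p \<theta>) (\<lambda>x. B t (p \<theta>) x $ a) (tangent p \<theta> i) =
      ((expect (p \<theta>) (\<lambda>x. score p \<theta> i x *\<^sub>R f x t) + Sx *v expect (p \<theta>) (grad (score p \<theta> i)))
         v* (transpose C ** matrix_inv (obs_cov C Sx Su))) $ a" for i a
    unfolding fisher_inner_def quot by (rule projected_noise[OF proj int_B[unfolded quot]])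
  then show "projection_gain p B \<theta> t = explicit_gain C Sx Su f p \<theta> t"
    by (simp add: projection_gain_def projection_coord_def explicit_gain_def vec_eq_iff)
qed

text \<open>With \<open>P\<close> the information matrix, the derived order of factors gives
  \<open>Sx - Sx ** P ** Sx\<close>, the swapped one \<open>Sx - Sx ** Sx ** P\<close>. Commutation
  makes them the same matrix.\<close>

lemma modified_generator_swapped_eq:
  "Sx ** attenuation C Sx Su = attenuation C Sx Su ** Sx \<Longrightarrow>
    modified_generator_swapped C Sx Su = modified_generator C Sx Su"
  by (simp add: fun_eq_iff modified_generator_swapped_def modified_generator_def matrix_mul_assoc[symmetric])

theorem theorem1:
  fixes M :: "'w measure" and F :: "real \<Rightarrow> 'w measure"
    and f :: "real^'n::finite \<Rightarrow> real \<Rightarrow> real^'n"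
    and C :: "real^'n^'m::finite"
    and Sx Rx :: "real^'n^'n" and Su Ru R :: "real^'m^'m"
    and W X :: "real \<Rightarrow> 'w \<Rightarrow> real^'n" and V U :: "real \<Rightarrow> 'w \<Rightarrow> real^'m"
    and \<Theta> :: "(real^'k::finite) set" and p :: "real^'k \<Rightarrow> real^'n \<Rightarrow> real"
    and A :: "real \<Rightarrow> (real^'n \<Rightarrow> real) \<Rightarrow> real^'n \<Rightarrow> real"
    and B :: "real \<Rightarrow> (real^'n \<Rightarrow> real) \<Rightarrow> real^'n \<Rightarrow> real^'m"
  assumes C_invertible: "invertible C"
    and Sx: "covariance_matrix Sx" and Su: "covariance_matrix Su"
    and Rx: "is_sqrt_of Rx Sx" and Ru: "is_sqrt_of Ru Su"
    and obs_invertible: "invertible (obs_cov C Sx Su)"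
    and R: "is_sqrt_of R (obs_cov C Sx Su)"
    and model: "filtering_model M F f C Rx Ru W V X U"
    and f_regular: "\<And>t k. 0 \<le> t \<Longrightarrow> C1 (\<lambda>x. f x t $ k)"
    and family: "regular_family \<Theta> p"
    and moments: "\<And>t \<theta> i. 0 \<le> t \<Longrightarrow> \<theta> \<in> \<Theta> \<Longrightarrow> moments_exist (\<lambda>x. f x t) (p \<theta>) (score p \<theta> i)"
    and density_form: "\<And>t \<theta>. 0 \<le> t \<Longrightarrow> \<theta> \<in> \<Theta> \<Longrightarrow>
       stratonovich_density_form C Sx Su (\<lambda>x. f x t) (p \<theta>) (A t (p \<theta>)) (B t (p \<theta>))"
    and inner_exists_A: "\<And>t \<theta> i. 0 \<le> t \<Longrightarrow> \<theta> \<in> \<Theta> \<Longrightarrow>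
       integrable lborel (\<lambda>x. A t (p \<theta>) x * tangent p \<theta> i x / p \<theta> x)"
    and inner_exists_B: "\<And>t \<theta> i a. 0 \<le> t \<Longrightarrow> \<theta> \<in> \<Theta> \<Longrightarrow>
       integrable lborel (\<lambda>x. B t (p \<theta>) x $ a * tangent p \<theta> i x / p \<theta> x)"
  shows
    "(\<forall>\<theta>\<in>\<Theta>. \<forall>t\<ge>0.
        projection_drift p A \<theta> t =
          explicit_drift C Sx Su R f p (\<lambda>t. modified_generator C Sx Su (\<lambda>x. f x t)) \<theta> t \<and>
        projection_gain p B \<theta> t = explicit_gain C Sx Su f p \<theta> t) \<and>
     (\<forall>\<theta>. solves_stratonovich_sde M F \<Theta> (projection_drift p A) (projection_gain p B) U \<theta> \<longleftrightarrow>
        solves_stratonovich_sde M F \<Theta>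
          (explicit_drift C Sx Su R f p (\<lambda>t. modified_generator C Sx Su (\<lambda>x. f x t)))
          (explicit_gain C Sx Su f p) U \<theta>) \<and>
     (Sx ** attenuation C Sx Su = attenuation C Sx Su ** Sx \<longrightarrow>
       (\<forall>\<theta>\<in>\<Theta>. \<forall>t\<ge>0.
          projection_drift p A \<theta> t =
            explicit_drift C Sx Su R f p (\<lambda>t. modified_generator_swapped C Sx Su (\<lambda>x. f x t)) \<theta> t) \<and>
       (\<forall>\<theta>. solves_stratonovich_sde M F \<Theta> (projection_drift p A) (projection_gain p B) U \<theta> \<longleftrightarrow>
          solves_stratonovich_sde M F \<Theta>
            (explicit_drift C Sx Su R f p (\<lambda>t. modified_generator_swapped C Sx Su (\<lambda>x. f x t)))
            (explicit_gain C Sx Su f p) U \<theta>))"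
proof -
  have eq: "projection_drift p A \<theta> t =
        explicit_drift C Sx Su R f p (\<lambda>t. modified_generator C Sx Su (\<lambda>x. f x t)) \<theta> t"
      "projection_gain p B \<theta> t = explicit_gain C Sx Su f p \<theta> t"
    if "\<theta> \<in> \<Theta>" "0 \<le> t" for \<theta> t
    by (rule projection_eq_explicit[where A=A and B=B and f=f and p=p and \<theta>=\<theta> and t=t,
          OF C_invertible Sx Su obs_invertible R f_regular[OF that(2)] family that(1) moments[OF that(2,1)] density_form[OF that(2,1)] inner_exists_A[OF that(2,1)] inner_exists_B[OF that(2,1)]])+
  have sde: "solves_stratonovich_sde M F \<Theta> (projection_drift p A) (projection_gain p B) U \<theta> \<longleftrightarrow>
        solves_stratonovich_sde M F \<Theta>
          (explicit_drift C Sx Su R f p (\<lambda>t. modified_generator C Sx Su (\<lambda>x. f x t)))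
          (explicit_gain C Sx Su f p) U \<theta>" for \<theta>
    \<comment> \<open>Equality of the coefficients on \<Theta> at nonnegative times gives both
      equations the same solutions.\<close>
    by (rule solves_stratonovich_sde_cong) (simp_all add: eq)
  show ?thesis
    using eq sde by (simp add: modified_generator_swapped_eq)
qed

end
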